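(* Let $k$ be a positive integer, let $G$ be a balanced bipartite graph of order $2n > 6(k+1)$, and let $M$ be a perfect matching of $G$. Suppose that $G$ contains $k+1$ vertex-disjoint $M$-cycles, each of length at least $6$. If $\sigma_{1,1}(G) \ge n+2$, then $G$ has an $M$-$2$-factor consisting of exactly $k$ cycles, each of length at least $6$.
   Context: Graphs are finite and simple. For a bipartite graph $G$ with partite sets $X,Y$, $\sigma_{1,1}(G) = \min\{d_G(x)+d_G(y) : x \in X, y \in Y, xy \notin E(G)\}$ if $G$ is not complete bipartite, and $+\infty$ otherwise. For a matching $M$, a cycle $C$ is an $M$-cycle if $|E(C)\cap M|=|C|/2$ (it alternates between edges in $M$ and not in $M$). An $M$-$2$-factor is a spanning subgraph every component of which is an $M$-cycle. *)

theory Defs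
  imports Main "HOL-Library.Extended_Nat"
begin

definition bipartite_graph :: "'a set \<Rightarrow> 'a set \<Rightarrow> 'a set set \<Rightarrow> bool" where
  "bipartite_graph X Y E \<longleftrightarrow> finite X \<and> finite Y \<and> X \<inter> Y = {} \<and>
     E \<subseteq> {{x, y} | x y. x \<in> X \<and> y \<in> Y}"

definition degree :: "'a set set \<Rightarrow> 'a \<Rightarrow> nat" where
  "degree E v = card {u. {u, v} \<in> E}"

definition sigma11 :: "'a set \<Rightarrow> 'a set \<Rightarrow> 'a set set \<Rightarrow> enat" where
  "sigma11 X Y E =
     (if \<forall>x\<in>X. \<forall>y\<in>Y. {x, y} \<in> E then \<infinity>
      else enat (Min {degree E x + degree E y | x y. x \<in> X \<and> y \<in> Y \<and> {x, y} \<notin> E}))"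

definition perfect_matching :: "'a set \<Rightarrow> 'a set set \<Rightarrow> 'a set set \<Rightarrow> bool" where
  "perfect_matching V E M \<longleftrightarrow> M \<subseteq> E \<and> (\<forall>v\<in>V. \<exists>!e. e \<in> M \<and> v \<in> e)"

definition is_cycle :: "'a set set \<Rightarrow> 'a list \<Rightarrow> bool" where
  "is_cycle E vs \<longleftrightarrow> length vs \<ge> 3 \<and> distinct vs \<and>
     (\<forall>i < length vs. {vs ! i, vs ! ((i + 1) mod length vs)} \<in> E)"

definition cycle_edges :: "'a list \<Rightarrow> 'a set set" where
  "cycle_edges vs = {{vs ! i, vs ! ((i + 1) mod length vs)} | i. i < length vs}"

definition M_cycle :: "'a set set \<Rightarrow> 'a set set \<Rightarrow> 'a list \<Rightarrow> bool" where
  "M_cycle E M vs \<longleftrightarrow> is_cycle E vs \<and> 2 * card (cycle_edges vs \<inter> M) = length vs"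

definition vertex_disjoint :: "'a list list \<Rightarrow> bool" where
  "vertex_disjoint cs \<longleftrightarrow>
     (\<forall>i < length cs. \<forall>j < length cs. i \<noteq> j \<longrightarrow> set (cs ! i) \<inter> set (cs ! j) = {})"

definition M_two_factor :: "'a set \<Rightarrow> 'a set set \<Rightarrow> 'a set set \<Rightarrow> 'a list list \<Rightarrow> bool" where
  "M_two_factor V E M cs \<longleftrightarrow> vertex_disjoint cs \<and> (\<forall>c \<in> set cs. M_cycle E M c) \<and>
     (\<Union>c \<in> set cs. set c) = V"

end

(*
  Contract the matching: on X put an arc from x to x' if x is adjacent to the partner of x'.
  The M-cycles of length 2l become the directed cycles of length l, and the degree condition
  becomes Woodall's: outdeg u + indeg v >= n whenever there is no arc from u to v.

  If a packing of k+1 directed cycles of maximal total length misses some vertices, these have a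
  Hamiltonian cycle by Woodall's theorem, and it can be merged with two of the cycles, which gives
  a partition into k cycles. So suppose that k+1 cycles cover everything, but that there is no
  partition into k cycles. A path whose ends are attached to a cycle can be absorbed by the cycles
  (exchange argument), hence between two of the cycles all arcs have the same direction. Because
  n > 3(k+1), some cycle C has more than three vertices. It has no chords, and the degree condition
  forces that it has four vertices and that all other vertices are in the set A of vertices that
  dominate C or in the set B of vertices dominated by C. Counting arcs from B to A shows
  |B| + 3 <= |A| or B = {}; reversing all arcs exchanges A and B, a contradiction.
*)

theory Submission
  imports Defs "HOL-Library.Multiset"
begin

subsection \<open>Closed walks and degrees\<close>

text \<open>All exchanges rest on one count: if the in-degree of \<open>u\<close> from a cycle plus
  the out-degree of \<open>v\<close> into it exceeds its length, then some consecutive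
  \<open>w\<close>, \<open>w'\<close> have arcs from \<open>w\<close> to \<open>u\<close> and from
  \<open>v\<close> to \<open>w'\<close>, and a path from \<open>u\<close> to \<open>v\<close> fits
  between them. The constant \<open>n + 2\<close> is what this count asks for: each degree loses its
  matching edge, which leaves \<open>n\<close>. The obstacle in the exchange argument is that
  several segments may need the same gap; a whole run of consecutive segments is then inserted there
  at once. Woodall's theorem comes from the same merging argument, applied to a longest cycle as a
  packing with one member. That a cycle has no chords concerns only vertices that are not
  consecutive: the reverse of a cycle arc closes a directed cycle of length 2, an M-cycle of length
  4, and cannot be excluded. Hence degrees inside a cycle are bounded by 2 and not by 1. For a
  non-arc inside \<open>C\<close> this gives at most four vertices, with equality throughout once
  \<open>C\<close> has four; the bound \<open>2 * n > 6 * (k + 1)\<close> provides such a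
  cycle.\<close>

definition closed_walk :: "('a \<Rightarrow> 'a \<Rightarrow> bool) \<Rightarrow> 'a list \<Rightarrow> bool" where
  "closed_walk r xs \<longleftrightarrow> xs \<noteq> [] \<and> successively r xs \<and> r (last xs) (hd xs)"

text \<open>\<open>closed_walk\<close> allows repeated vertices; distinctness is demanded once, of
  the concatenation, so that a rearrangement of cycles only has to preserve a multiset of vertices.
  The exchanges work for \<open>m <= 3\<close>, because three nonempty pieces already have three
  vertices: \<open>m = 0\<close> serves Woodall's theorem, and \<open>m = 3\<close> stands for
  M-cycles of length at least 6.\<close>

definition cycle_partition :: "('a \<Rightarrow> 'a \<Rightarrow> bool) \<Rightarrow> nat \<Rightarrow> nat \<Rightarrow> 'a set \<Rightarrow> bool" where
  "cycle_partition r m K V \<longleftrightarrow> (\<exists>Cs. length Cs = K \<and> (\<forall>C\<in>set Cs. closed_walk r C \<and> m \<le> length C) \<and>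
     distinct (concat Cs) \<and> set (concat Cs) = V)"

definition outdeg :: "('a \<Rightarrow> 'a \<Rightarrow> bool) \<Rightarrow> 'a set \<Rightarrow> 'a \<Rightarrow> nat" where
  "outdeg r X u = card {v \<in> X. r u v}"

definition indeg :: "('a \<Rightarrow> 'a \<Rightarrow> bool) \<Rightarrow> 'a set \<Rightarrow> 'a \<Rightarrow> nat" where
  "indeg r X v = card {u \<in> X. r u v}"

definition woodall :: "('a \<Rightarrow> 'a \<Rightarrow> bool) \<Rightarrow> 'a set \<Rightarrow> bool" where
  "woodall r V \<longleftrightarrow> (\<forall>u\<in>V. \<forall>v\<in>V. u \<noteq> v \<longrightarrow> \<not> r u v \<longrightarrow> card V \<le> outdeg r V u + indeg r V v)"

lemma woodallD: "woodall r V \<Longrightarrow> u \<in> V \<Longrightarrow> v \<in> V \<Longrightarrow> u \<noteq> v \<Longrightarrow> \<not> r u v \<Longrightarrow> card V \<le> outdeg r V u + indeg r V v"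
  by (auto simp: woodall_def)

lemma outdeg_Un: "finite X \<Longrightarrow> finite Y \<Longrightarrow> outdeg r (X \<union> Y) u \<le> outdeg r X u + outdeg r Y u"
proof -
  have "{v \<in> X \<union> Y. r u v} = {v \<in> X. r u v} \<union> {v \<in> Y. r u v}" by auto
  then show ?thesis by (simp add: outdeg_def card_Un_le)
qed

lemma indeg_Un: "finite X \<Longrightarrow> finite Y \<Longrightarrow> indeg r (X \<union> Y) u \<le> indeg r X u + indeg r Y u"
proof -
  have "{v \<in> X \<union> Y. r v u} = {v \<in> X. r v u} \<union> {v \<in> Y. r v u}" by auto
  then show ?thesis by (simp add: indeg_def card_Un_le)
qed

lemma outdeg_le_card: "finite X \<Longrightarrow> outdeg r X u \<le> card X"
  unfolding outdeg_def by (auto intro: card_mono)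

lemma outdeg_less_card: "finite X \<Longrightarrow> v \<in> X \<Longrightarrow> \<not> r u v \<Longrightarrow> outdeg r X u < card X"
  unfolding outdeg_def by (rule psubset_card_mono) auto

lemma indeg_less_card: "finite X \<Longrightarrow> v \<in> X \<Longrightarrow> \<not> r v u \<Longrightarrow> indeg r X u < card X"
  unfolding indeg_def by (rule psubset_card_mono) auto

lemma outdeg_eq_0: "(\<And>v. v \<in> X \<Longrightarrow> \<not> r u v) \<Longrightarrow> outdeg r X u = 0"
  unfolding outdeg_def by (metis (mono_tags, lifting) Collect_empty_eq card.empty)

lemma indeg_eq_0: "(\<And>v. v \<in> X \<Longrightarrow> \<not> r v u) \<Longrightarrow> indeg r X u = 0"
  unfolding indeg_def by (metis (mono_tags, lifting) Collect_empty_eq card.empty)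

lemma outdeg_insert: "finite X \<Longrightarrow> x \<notin> X \<Longrightarrow> outdeg r (insert x X) u = (if r u x then 1 else 0) + outdeg r X u"
proof -
  assume "finite X" "x \<notin> X"
  moreover have "{v \<in> insert x X. r u v} = (if r u x then insert x {v \<in> X. r u v} else {v \<in> X. r u v})" by auto
  ultimately show ?thesis by (auto simp: outdeg_def)
qed

lemma indeg_insert: "finite X \<Longrightarrow> x \<notin> X \<Longrightarrow> indeg r (insert x X) u = (if r x u then 1 else 0) + indeg r X u"
proof -
  assume "finite X" "x \<notin> X"
  moreover have "{v \<in> insert x X. r v u} = (if r x u then insert x {v \<in> X. r v u} else {v \<in> X. r v u})" by auto
  ultimately show ?thesis by (auto simp: indeg_def)
qed

text \<open>Consecutive pairs are the places where a path can be inserted, so the arguments are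
  formulated with them instead of indices.\<close>

definition gap :: "'a list \<Rightarrow> 'a \<Rightarrow> 'a \<Rightarrow> bool" where
  "gap xs w w' \<longleftrightarrow> (\<exists>A B. xs = A @ w # w' # B)"

definition cyc_gap :: "'a list \<Rightarrow> 'a \<Rightarrow> 'a \<Rightarrow> bool" where
  "cyc_gap xs w w' \<longleftrightarrow> gap xs w w' \<or> xs \<noteq> [] \<and> w = last xs \<and> w' = hd xs"

lemma gap_Cons: "gap xs w w' \<Longrightarrow> gap (x # xs) w w'"
  unfolding gap_def by (metis append_Cons)

lemma gap_append1: "gap xs w w' \<Longrightarrow> gap (xs @ ys) w w'"
  unfolding gap_def by fastforce

lemma gap_append2: "gap ys w w' \<Longrightarrow> gap (xs @ ys) w w'"
  unfolding gap_def by (metis append.assoc)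

lemma gap_mem: "gap xs w w' \<Longrightarrow> w \<in> set xs \<and> w' \<in> set xs"
  unfolding gap_def by auto

text \<open>Every gap contributes at most one arc, the two ends of the path contribute the corrections.\<close>
lemma path_degree_sum_aux:
  assumes "xs \<noteq> []" "distinct xs" "\<And>w w'. gap xs w w' \<Longrightarrow> \<not> (r w u \<and> r v w')"
  shows "indeg r (set xs) u + outdeg r (set xs) v + 1 \<le>
    length xs + (if r v (hd xs) then 1 else 0) + (if r (last xs) u then 1 else 0)"
  using assms
proof (induction xs rule: list_nonempty_induct)
  case (single x)
  then show ?case by (auto simp: indeg_insert outdeg_insert) (auto simp: indeg_def outdeg_def)
next
  case (cons x xs)
  then obtain y ys where xs: "xs = y # ys" by (cases xs) auto
  have "\<not> (r x u \<and> r v y)"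
    using cons.prems(2)[of x y] by (auto simp: gap_def xs)
  moreover have "indeg r (set xs) u + outdeg r (set xs) v + 1 \<le>
    length xs + (if r v (hd xs) then 1 else 0) + (if r (last xs) u then 1 else 0)"
    using cons.prems cons.IH gap_Cons by fastforce
  moreover have "indeg r (set (x # xs)) u = (if r x u then 1 else 0) + indeg r (set xs) u"
    "outdeg r (set (x # xs)) v = (if r v x then 1 else 0) + outdeg r (set xs) v"
    using cons.prems(1) by (simp_all add: indeg_insert outdeg_insert)
  ultimately show ?case using cons.hyps by (auto simp: xs split: if_splits)
qed

text \<open>The extra 1 stems from the missing closing gap: an arc from the last vertex to
  \<open>u\<close> and an arc from \<open>v\<close> to the first vertex may both be present. On a
  cycle these two exclude each other, so \<open>cycle_degree_sum\<close> has no correction.\<close>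

lemma path_degree_sum:
  assumes "xs \<noteq> []" "distinct xs" "\<And>w w'. gap xs w w' \<Longrightarrow> \<not> (r w u \<and> r v w')"
  shows "indeg r (set xs) u + outdeg r (set xs) v \<le> length xs + 1"
  using path_degree_sum_aux[where r = r and u = u and v = v, OF assms(1,2)] assms(3)
  by (simp split: if_splits)

lemma cycle_degree_sum:
  assumes "distinct xs" "\<And>w w'. cyc_gap xs w w' \<Longrightarrow> \<not> (r w u \<and> r v w')"
  shows "indeg r (set xs) u + outdeg r (set xs) v \<le> length xs"
proof (cases "xs = []")
  case True
  then show ?thesis by (simp add: indeg_def outdeg_def)
next
  case False
  then have "\<not> (r (last xs) u \<and> r v (hd xs))" using assms(2) by (auto simp: cyc_gap_def)
  moreover have "\<And>w w'. gap xs w w' \<Longrightarrow> \<not> (r w u \<and> r v w')" using assms(2) by (auto simp: cyc_gap_def)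
  ultimately show ?thesis
    using path_degree_sum_aux[where r = r and u = u and v = v, OF False assms(1)] by (simp split: if_splits)
qed

lemma concat_degree_sum:
  assumes "\<And>L. L \<in> set Ls \<Longrightarrow> indeg r (set L) u + outdeg r (set L) v \<le> length L"
  shows "indeg r (set (concat Ls)) u + outdeg r (set (concat Ls)) v \<le> length (concat Ls)"
  using assms
proof (induction Ls)
  case Nil
  then show ?case by (simp add: indeg_def outdeg_def)
next
  case (Cons L Ls)
  have "indeg r (set (concat (L # Ls))) u \<le> indeg r (set L) u + indeg r (set (concat Ls)) u"
    "outdeg r (set (concat (L # Ls))) v \<le> outdeg r (set L) v + outdeg r (set (concat Ls)) v"
    using indeg_Un[of "set L" "set (concat Ls)"] outdeg_Un[of "set L" "set (concat Ls)"] by auto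
  moreover have "indeg r (set L) u + outdeg r (set L) v \<le> length L" using Cons.prems by simp
  moreover have "indeg r (set (concat Ls)) u + outdeg r (set (concat Ls)) v \<le> length (concat Ls)"
    using Cons by simp
  ultimately show ?case by simp
qed

section \<open>Rotating, cutting and extending closed walks\<close>

lemma closed_walk_append:
  "xs \<noteq> [] \<Longrightarrow> ys \<noteq> [] \<Longrightarrow> closed_walk r (xs @ ys) \<longleftrightarrow>
     successively r xs \<and> successively r ys \<and> r (last xs) (hd ys) \<and> r (last ys) (hd xs)"
  by (auto simp: closed_walk_def successively_append_iff)

lemma closed_walk_rotate: "closed_walk r (xs @ ys) \<longleftrightarrow> closed_walk r (ys @ xs)"
  by (cases "xs = []"; cases "ys = []") (auto simp: closed_walk_append)

text \<open>The segment \<open>Q\<close> is what remains of the cycle when a detour that leaves it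
  at \<open>x\<close> and returns at \<open>y\<close> replaces \<open>S\<close>. Both
  \<open>x = y\<close> and an empty \<open>S\<close> are possible.\<close>

lemma closed_walk_split:
  assumes "closed_walk r C" "x \<in> set C" "y \<in> set C"
  obtains Q S where "Q \<noteq> []" "hd Q = y" "last Q = x" "mset (Q @ S) = mset C" "closed_walk r (Q @ S)"
proof -
  obtain A B where AB: "C = A @ y # B" using assms(3) by (meson split_list)
  define C1 where "C1 = y # B @ A"
  have "closed_walk r C1" using closed_walk_rotate[of r A "y # B"] assms(1) by (simp add: AB C1_def)
  moreover have "x \<in> set C1" using assms(2) by (auto simp: AB C1_def)
  then obtain D S where D: "C1 = D @ x # S" by (meson split_list)
  moreover have "hd (D @ [x]) = y" using D by (cases D) (auto simp: C1_def)
  moreover have "mset C1 = mset C" by (simp add: AB C1_def)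
  ultimately show ?thesis using that[of "D @ [x]" S] by simp
qed

lemma gap_Cons_iff: "gap (x # xs) p q \<longleftrightarrow> xs \<noteq> [] \<and> p = x \<and> q = hd xs \<or> gap xs p q"
proof
  assume "gap (x # xs) p q"
  then obtain A B where "x # xs = A @ p # q # B" by (auto simp: gap_def)
  then show "xs \<noteq> [] \<and> p = x \<and> q = hd xs \<or> gap xs p q"
    by (cases A) (auto simp: gap_def)
next
  assume "xs \<noteq> [] \<and> p = x \<and> q = hd xs \<or> gap xs p q"
  then show "gap (x # xs) p q"
    using gap_Cons by (metis append_Nil gap_def list.collapse)
qed

lemma gap_insert_mono:
  assumes "gap (A @ w # w' # B) p q" "(p, q) \<noteq> (w, w')"
  shows "gap (A @ w # xs @ w' # B) p q"
  using assms
proof (induction A)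
  case Nil
  then have "gap (w' # B) p q" by (auto simp: gap_Cons_iff)
  then show ?case using gap_append2[of _ p q "w # xs"] by simp
next
  case (Cons a A)
  then show ?case by (cases A) (auto simp: gap_Cons_iff)
qed

text \<open>The last property makes repeated insertion possible: of the old gaps only the one that
  is used may be lost. The closing gap is filled by appending.\<close>

lemma cyc_gap_insert:
  assumes "closed_walk r L" "cyc_gap L w w'" "xs \<noteq> []" "successively r xs" "r w (hd xs)" "r (last xs) w'"
  obtains L' where "closed_walk r L'" "mset L' = mset L + mset xs"
    "\<And>p q. cyc_gap L p q \<Longrightarrow> (p, q) \<noteq> (w, w') \<Longrightarrow> cyc_gap L' p q"
proof (cases "gap L w w'")
  case True
  then obtain A B where L: "L = A @ w # w' # B" by (auto simp: gap_def)
  define L' where "L' = A @ w # xs @ w' # B"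
  have "closed_walk r L'" using assms
    by (cases A) (auto simp: closed_walk_def L'_def L successively_append_iff successively_Cons hd_append split: if_splits)
  moreover have "mset L' = mset L + mset xs" by (simp add: L L'_def)
  moreover have "cyc_gap L' p q" if "cyc_gap L p q" "(p, q) \<noteq> (w, w')" for p q
  proof (cases "gap L p q")
    case True
    then have "gap L' p q" using gap_insert_mono that(2) by (simp add: L L'_def)
    then show ?thesis by (simp add: cyc_gap_def)
  next
    case False
    then show ?thesis using that by (cases A) (auto simp: cyc_gap_def L L'_def split: if_splits)
  qed
  ultimately show ?thesis using that by blast
next
  case False
  then have w: "w = last L" "w' = hd L" "L \<noteq> []" using assms by (auto simp: cyc_gap_def closed_walk_def)
  have "closed_walk r (L @ xs)" using assms w by (auto simp: closed_walk_def successively_append_iff)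
  moreover have "cyc_gap (L @ xs) p q" if "cyc_gap L p q" "(p, q) \<noteq> (w, w')" for p q
  proof -
    have "gap L p q" using that w by (auto simp: cyc_gap_def)
    then show ?thesis using gap_append1[of L p q xs] by (simp add: cyc_gap_def)
  qed
  ultimately show ?thesis using that[of "L @ xs"] by simp
qed

lemma gap_insert:
  assumes "successively r L" "gap L w w'" "xs \<noteq> []" "successively r xs" "r w (hd xs)" "r (last xs) w'"
  obtains L' where "successively r L'" "L' \<noteq> []" "hd L' = hd L" "last L' = last L" "mset L' = mset L + mset xs"
    "\<And>p q. gap L p q \<Longrightarrow> (p, q) \<noteq> (w, w') \<Longrightarrow> gap L' p q"
proof -
  obtain A B where L: "L = A @ w # w' # B" using assms by (auto simp: gap_def)
  define L' where "L' = A @ w # xs @ w' # B"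
  have "successively r L'" using assms
    by (cases A) (auto simp: L'_def L successively_append_iff successively_Cons hd_append split: if_splits)
  moreover have "mset L' = mset L + mset xs" by (simp add: L L'_def)
  moreover have "hd L' = hd L" "last L' = last L" by (cases A; simp add: L L'_def)+
  moreover have "gap L' p q" if "gap L p q" "(p, q) \<noteq> (w, w')" for p q
    using gap_insert_mono that by (simp add: L L'_def)
  moreover have "L' \<noteq> []" by (simp add: L'_def)
  ultimately show ?thesis using that by blast
qed

subsection \<open>Absorbing a path into a cycle\<close>

text \<open>Vertices can be moved into the path \<open>Q\<close> or into one of the cycles
  \<open>Ls\<close>. The two ends of \<open>Q\<close> form no slot, because they carry the arcs by
  which \<open>Q\<close> will be closed to a cycle.\<close>

definition slot :: "'a list \<Rightarrow> 'a list list \<Rightarrow> 'a \<Rightarrow> 'a \<Rightarrow> bool" where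
  "slot Q Ls w w' \<longleftrightarrow> gap Q w w' \<or> (\<exists>L\<in>set Ls. cyc_gap L w w')"

definition insertable :: "('a \<Rightarrow> 'a \<Rightarrow> bool) \<Rightarrow> 'a list \<Rightarrow> 'a list list \<Rightarrow> 'a list \<Rightarrow> bool" where
  "insertable r Q Ls xs \<longleftrightarrow> (\<exists>w w'. slot Q Ls w w' \<and> r w (hd xs) \<and> r (last xs) w')"

lemma slot_insert:
  assumes "successively r Q" "Q \<noteq> []" "\<forall>L\<in>set Ls. closed_walk r L \<and> m \<le> length L"
    and "slot Q Ls w w'" "xs \<noteq> []" "successively r xs" "r w (hd xs)" "r (last xs) w'"
  obtains Q' Ls' where "successively r Q'" "Q' \<noteq> []" "hd Q' = hd Q" "last Q' = last Q" "length Q \<le> length Q'"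
    "\<forall>L\<in>set Ls'. closed_walk r L \<and> m \<le> length L" "length Ls' = length Ls"
    "mset (Q' @ concat Ls') = mset (Q @ concat Ls) + mset xs"
    "\<And>p q. slot Q Ls p q \<Longrightarrow> (p, q) \<noteq> (w, w') \<Longrightarrow> slot Q' Ls' p q"
proof (cases "gap Q w w'")
  case True
  from gap_insert[OF assms(1) True assms(5-8)] obtain Q' where "successively r Q'" "Q' \<noteq> []"
    "hd Q' = hd Q" "last Q' = last Q" "mset Q' = mset Q + mset xs"
    "\<And>p q. gap Q p q \<Longrightarrow> (p, q) \<noteq> (w, w') \<Longrightarrow> gap Q' p q" by metis
  moreover from this(5) have "length Q \<le> length Q'" by (metis le_add1 size_mset size_union)
  ultimately show ?thesis using that[of Q' Ls] assms(3) by (auto simp: slot_def)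
next
  case False
  then obtain L where L: "L \<in> set Ls" "cyc_gap L w w'" using assms(4) by (auto simp: slot_def)
  obtain A B where AB: "Ls = A @ L # B" using L(1) by (meson split_list)
  from cyc_gap_insert[OF _ L(2) assms(5-8)] assms(3) L(1) obtain L' where L': "closed_walk r L'"
    "mset L' = mset L + mset xs" "\<And>p q. cyc_gap L p q \<Longrightarrow> (p, q) \<noteq> (w, w') \<Longrightarrow> cyc_gap L' p q" by metis
  have "length L' = length L + length xs" using arg_cong[OF L'(2), of size] by simp
  then show ?thesis
  proof (intro that[of Q "A @ L' # B"])
    show "\<forall>M\<in>set (A @ L' # B). closed_walk r M \<and> m \<le> length M"
      using assms(3) L(1) L'(1) \<open>length L' = _\<close> by (auto simp: AB)
    show "slot Q (A @ L' # B) p q" if "slot Q Ls p q" "(p, q) \<noteq> (w, w')" for p q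
      using that L'(3)[of p q] by (auto simp: slot_def AB)
  qed (use assms(1,2) L'(2) in \<open>auto simp: AB\<close>)
qed

text \<open>The first part is inserted together with everything up to the last part that still fits in
  front of the same vertex, so that no later part needs this slot.\<close>
lemma multi_insert:
  assumes "successively r Q" "Q \<noteq> []" "\<forall>L\<in>set Ls. closed_walk r L \<and> m \<le> length L"
    and "successively r (concat xss)" "\<And>xs. xs \<in> set xss \<Longrightarrow> xs \<noteq> [] \<and> insertable r Q Ls xs"
  obtains Q' Ls' where "successively r Q'" "Q' \<noteq> []" "hd Q' = hd Q" "last Q' = last Q" "length Q \<le> length Q'"
    "\<forall>L\<in>set Ls'. closed_walk r L \<and> m \<le> length L" "length Ls' = length Ls"
    "mset (Q' @ concat Ls') = mset (Q @ concat Ls) + mset (concat xss)"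
  using assms
proof (induction "length xss" arbitrary: Q Ls xss thesis rule: less_induct)
  case less
  show ?case
  proof (cases xss)
    case Nil
    then show ?thesis using less.prems(1)[of Q Ls] less.prems(2-) by simp
  next
    case (Cons x rest)
    then obtain w w' where w: "slot Q Ls w w'" "r w (hd x)" "r (last x) w'"
      using less.prems(6)[of x] by (auto simp: insertable_def)
    have "\<exists>y\<in>set xss. r (last y) w'" using w Cons by auto
    from split_list_last_prop[OF this] obtain ys z zs where
      z: "xss = ys @ z # zs" "r (last z) w'" "\<And>y. y \<in> set zs \<Longrightarrow> \<not> r (last y) w'" by blast
    define X where "X = concat (ys @ [z])"
    have mem: "z \<in> set xss" "x \<in> set xss" by (simp add: z(1), simp add: Cons)
    then have ne: "z \<noteq> []" "x \<noteq> []" using less.prems(6) by blast+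
    have X: "X \<noteq> []" "last X = last z" "successively r X" "hd X = hd x"
      using ne less.prems(5) z(1) Cons
      by (auto simp: X_def successively_append_iff) (cases ys; simp)+
    from slot_insert[OF less.prems(2-4) w(1) X(1,3)] w(2) z(2) X obtain Q1 Ls1 where
      Q1: "successively r Q1" "Q1 \<noteq> []" "hd Q1 = hd Q" "last Q1 = last Q" "length Q \<le> length Q1"
        "\<forall>L\<in>set Ls1. closed_walk r L \<and> m \<le> length L" "length Ls1 = length Ls"
        "mset (Q1 @ concat Ls1) = mset (Q @ concat Ls) + mset X"
        "\<And>p q. slot Q Ls p q \<Longrightarrow> (p, q) \<noteq> (w, w') \<Longrightarrow> slot Q1 Ls1 p q" by metis
    have ins: "y \<noteq> [] \<and> insertable r Q1 Ls1 y" if "y \<in> set zs" for y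
    proof -
      have "y \<in> set xss" using that z(1) by simp
      then obtain p q where "slot Q Ls p q" "r p (hd y)" "r (last y) q" "y \<noteq> []"
        using less.prems(6)[of y] unfolding insertable_def by blast
      then show ?thesis using Q1(9)[of p q] z(3)[OF that] by (auto simp: insertable_def)
    qed
    have "successively r (concat zs)" using less.prems(5) z(1) by (auto simp: successively_append_iff)
    note IH = less.hyps[where xss = zs, OF _ _ Q1(1,2,6) this ins]
    show ?thesis
    proof (rule IH)
      show "length zs < length xss" by (simp add: z(1))
    next
      fix Q' Ls'
      assume "successively r Q'" "Q' \<noteq> []" "hd Q' = hd Q1" "last Q' = last Q1" "length Q1 \<le> length Q'"
        "\<forall>L\<in>set Ls'. closed_walk r L \<and> m \<le> length L" "length Ls' = length Ls1"
        "mset (Q' @ concat Ls') = mset (Q1 @ concat Ls1) + mset (concat zs)"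
      then show thesis using less.prems(1)[of Q' Ls'] Q1 z(1) by (simp add: X_def)
    qed
  qed
qed

lemma cycle_partitionI:
  assumes "\<And>C. C \<in> set Cs \<Longrightarrow> closed_walk r C \<and> m \<le> length C"
    and "mset (concat Cs) = mset xs" "distinct xs" "set xs = V" "length Cs = K"
  shows "cycle_partition r m K V"
proof -
  have "distinct (concat Cs)" using assms(2,3) mset_eq_imp_distinct_iff by blast
  moreover have "set (concat Cs) = V" using assms(2,4) mset_eq_setD by blast
  ultimately show ?thesis using assms unfolding cycle_partition_def by blast
qed

lemma closed_walk_append3:
  assumes "xs \<noteq> []" "ys \<noteq> []" "zs \<noteq> []"
    and "successively r xs" "successively r ys" "successively r zs"
    and "r (last xs) (hd ys)" "r (last ys) (hd zs)" "r (last zs) (hd xs)"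
  shows "closed_walk r (xs @ ys @ zs)"
  using assms by (auto simp: closed_walk_def successively_append_iff)

text \<open>The picture: \<open>Q @ S\<close> is a cycle, \<open>us\<close> is a path attached to
  both ends of \<open>Q\<close>, so that it could replace \<open>S\<close>, and \<open>Ls\<close>
  are the other cycles. The aim is to cover \<open>V\<close> by \<open>Suc (length Ls)\<close>
  cycles. The bound 3 guarantees the minimal length when an extension of \<open>Q @ us\<close> is
  the cycle that is kept.\<close>

definition absorption :: "('a \<Rightarrow> 'a \<Rightarrow> bool) \<Rightarrow> nat \<Rightarrow> 'a set \<Rightarrow> 'a list \<Rightarrow> 'a list \<Rightarrow> 'a list \<Rightarrow> 'a list list \<Rightarrow> bool" where
  "absorption r m V Q S us Ls \<longleftrightarrow> Q \<noteq> [] \<and> us \<noteq> [] \<and> closed_walk r (Q @ S) \<and> closed_walk r (Q @ us) \<and>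
     3 \<le> length (Q @ us) \<and> m \<le> length (Q @ S) \<and> (\<forall>L\<in>set Ls. closed_walk r L \<and> m \<le> length L) \<and>
     distinct (Q @ S @ us @ concat Ls) \<and> set (Q @ S @ us @ concat Ls) = V"

text \<open>The 1 comes from the path \<open>Q\<close> alone; the cycles in \<open>Ls\<close> have
  no free ends.\<close>

lemma not_insertable_degree_sum:
  assumes "\<not> insertable r Q Ls xs" "distinct (Q @ concat Ls)" "Q \<noteq> []"
  shows "indeg r (set (Q @ concat Ls)) (hd xs) + outdeg r (set (Q @ concat Ls)) (last xs)
    \<le> length (Q @ concat Ls) + 1"
proof -
  have "indeg r (set Q) (hd xs) + outdeg r (set Q) (last xs) \<le> length Q + 1"
    using assms by (intro path_degree_sum) (auto simp: insertable_def slot_def)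
  moreover have "indeg r (set (concat Ls)) (hd xs) + outdeg r (set (concat Ls)) (last xs) \<le> length (concat Ls)"
    using assms
    by (intro concat_degree_sum cycle_degree_sum) (auto simp: insertable_def slot_def distinct_concat_iff)
  moreover have "indeg r (set (Q @ concat Ls)) (hd xs) \<le> indeg r (set Q) (hd xs) + indeg r (set (concat Ls)) (hd xs)"
    "outdeg r (set (Q @ concat Ls)) (last xs) \<le> outdeg r (set Q) (last xs) + outdeg r (set (concat Ls)) (last xs)"
    unfolding set_append by (rule indeg_Un outdeg_Un; simp)+
  ultimately show ?thesis by simp
qed

text \<open>The degree condition is added for the two crossing non-arcs, from \<open>last us\<close>
  to \<open>hd T\<close> and from \<open>last T\<close> to \<open>hd us\<close>. Regrouped by paths,
  each of \<open>us\<close> and \<open>T\<close> that cannot be inserted accounts for at most one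
  more than the number of vertices on \<open>Q\<close> and \<open>Ls\<close>, and each of the four
  degrees inside \<open>us\<close> and \<open>S\<close> misses the vertex itself. So twice
  \<open>card V\<close> would be at most twice \<open>card V\<close> minus 2.\<close>

lemma absorption_degree_sum:
  assumes W: "woodall r V" and irr: "\<And>x. \<not> r x x"
    and dist: "distinct (Q @ S @ us @ concat Ls)" and V: "set (Q @ S @ us @ concat Ls) = V"
    and ne: "Q \<noteq> []" "us \<noteq> []"
    and T: "hd T \<in> set S" "last T \<in> set S"
    and noS: "\<And>s. s \<in> set S \<Longrightarrow> \<not> r (last us) s \<and> \<not> r s (hd us)"
    and no_us: "\<And>v. v \<in> set us \<Longrightarrow> \<not> r v (hd T) \<and> \<not> r (last T) v"
  shows "insertable r Q Ls us \<or> insertable r Q Ls T"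
proof (rule ccontr)
  assume not: "\<not> ?thesis"
  let ?R = "set (Q @ concat Ls)"
  have VR: "V = ?R \<union> set us \<union> set S" using V by auto
  have u: "hd us \<in> set us" "last us \<in> set us" using ne by auto
  have neq: "last us \<noteq> hd T" "last T \<noteq> hd us" using u T dist by auto
  have le: "indeg r V x \<le> indeg r ?R x + indeg r (set us) x + indeg r (set S) x"
    "outdeg r V x \<le> outdeg r ?R x + outdeg r (set us) x + outdeg r (set S) x" for x
    using indeg_Un[of "?R \<union> set us" "set S" r x] indeg_Un[of "?R" "set us" r x]
      outdeg_Un[of "?R \<union> set us" "set S" r x] outdeg_Un[of "?R" "set us" r x] by (auto simp: VR)
  have "card V \<le> outdeg r V (last us) + indeg r V (hd T)"
    using T u noS neq VR by (intro woodallD[OF W]) auto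
  moreover have "card V \<le> outdeg r V (last T) + indeg r V (hd us)"
    using T u noS neq VR by (intro woodallD[OF W]) auto
  moreover have "indeg r ?R (hd us) + outdeg r ?R (last us) \<le> length (Q @ concat Ls) + 1"
    "indeg r ?R (hd T) + outdeg r ?R (last T) \<le> length (Q @ concat Ls) + 1"
    using not dist ne(1) not_insertable_degree_sum[of r Q Ls us] not_insertable_degree_sum[of r Q Ls T] by auto
  moreover have "indeg r (set us) (hd us) < length us" "outdeg r (set us) (last us) < length us"
    "indeg r (set S) (hd T) < length S" "outdeg r (set S) (last T) < length S"
    using indeg_less_card[of "set us" "hd us" r "hd us"] outdeg_less_card[of "set us" "last us" r "last us"]
      indeg_less_card[of "set S" "hd T" r "hd T"] outdeg_less_card[of "set S" "last T" r "last T"]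
      u T irr dist by (auto simp: distinct_card)
  moreover have "indeg r (set S) (hd us) = 0" "outdeg r (set S) (last us) = 0"
    "indeg r (set us) (hd T) = 0" "outdeg r (set us) (last T) = 0"
    using noS no_us by (auto intro!: indeg_eq_0 outdeg_eq_0)
  moreover have "card V = length (Q @ concat Ls) + length us + length S"
    using distinct_card[OF dist] V by simp
  ultimately show False
    using le(1)[of "hd us"] le(1)[of "hd T"] le(2)[of "last us"] le(2)[of "last T"] by linarith
qed

text \<open>Both ends of the path \<open>us\<close> are attached to the cycle \<open>Q @ S\<close>; the induction shortens \<open>us\<close> or
  the segment \<open>S\<close> that it is to replace. A minimal situation violates the degree condition for the
  ends of \<open>us\<close> and the first and last vertex of \<open>S\<close> that cannot be moved elsewhere.\<close>
lemma absorption_cycle_partition: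
  assumes W: "woodall r V" and irr: "\<And>x. \<not> r x x" and "m \<le> 3"
    and "absorption r m V Q S us Ls"
  shows "cycle_partition r m (Suc (length Ls)) V"
  using assms(4)
proof (induction "length us" arbitrary: Q S us Ls rule: less_induct)
  case outer: less
  from outer.prems outer.hyps show ?case
  proof (induction "length S" arbitrary: Q S Ls rule: less_induct)
    case less
    note conf = less.prems(1)
    note shorter_us = less.prems(2)
    have ne: "Q \<noteq> []" "us \<noteq> []" using conf by (auto simp: absorption_def)
    have sQ: "successively r Q" "successively r S" "successively r us"
      using conf by (auto simp: absorption_def closed_walk_def successively_append_iff)
    have ends: "r (last Q) (hd us)" "r (last us) (hd Q)"
      using conf ne by (auto simp: absorption_def closed_walk_append)
    have Ls: "\<forall>L\<in>set Ls. closed_walk r L \<and> m \<le> length L"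
      using conf by (auto simp: absorption_def)
    have dist: "distinct (Q @ S @ us @ concat Ls)" and V: "set (Q @ S @ us @ concat Ls) = V"
      using conf by (auto simp: absorption_def)
    have size3: "3 \<le> length Q + length us" and sizem: "m \<le> length Q + length S"
      using conf by (auto simp: absorption_def)
    let ?goal = "cycle_partition r m (Suc (length Ls)) V"
    have fin: ?goal if "closed_walk r C" "m \<le> length C" "length Ls' = length Ls"
      "\<forall>L\<in>set Ls'. closed_walk r L \<and> m \<le> length L"
      "mset (C @ concat Ls') = mset (Q @ S @ us @ concat Ls)" for C Ls'
      using that cycle_partitionI[OF _ _ dist V, of "C # Ls'" r m "Suc (length Ls)"] by auto
    show ?case
    proof (cases "S = []")
      case True
      then show ?thesis using fin[of "Q @ us" Ls] conf \<open>m \<le> 3\<close> Ls by (auto simp: absorption_def)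
    next
      case S: False
      have SQ: "r (last Q) (hd S)" "r (last S) (hd Q)"
        using conf ne S by (auto simp: absorption_def closed_walk_append)
      show ?thesis
      proof (cases "(\<exists>s\<in>set S. r (last us) s) \<or> (\<exists>s\<in>set S. r s (hd us))")
        case True
        then show ?thesis
        proof
          \<comment> \<open>The path may return already at \<open>s\<close>, so the part of
            \<open>S\<close> from \<open>s\<close> on joins \<open>Q\<close> and only
            \<open>S1\<close> is left to be replaced.\<close>
          assume "\<exists>s\<in>set S. r (last us) s"
          then obtain S1 s S2 where s: "S = S1 @ s # S2" "r (last us) s" by (metis split_list)
          have "absorption r m V (s # S2 @ Q) S1 us Ls"
            unfolding absorption_def
          proof (intro conjI)
            show "closed_walk r ((s # S2 @ Q) @ S1)"
              using conf s closed_walk_rotate[of r "Q @ S1" "s # S2"] by (simp add: absorption_def)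
            have "successively r (s # S2)" "last (s # S2) = last S"
              using sQ s by (auto simp: successively_append_iff)
            then have "successively r ((s # S2) @ Q @ us)"
              unfolding successively_append_iff using sQ SQ ends ne by simp
            then show "closed_walk r ((s # S2 @ Q) @ us)" using s(2) ne by (simp add: closed_walk_def)
          qed (use conf s in \<open>auto simp: absorption_def\<close>)
          then show ?thesis using less.hyps[of S1 "s # S2 @ Q" Ls] shorter_us s by simp
        next
          assume "\<exists>s\<in>set S. r s (hd us)"
          then obtain S1 s S2 where s: "S = S1 @ s # S2" "r s (hd us)" by (metis split_list)
          have "absorption r m V (Q @ S1 @ [s]) S2 us Ls"
            unfolding absorption_def
          proof (intro conjI)
            have "successively r (Q @ S1 @ [s])" "hd (S1 @ [s]) = hd S"
              using sQ SQ s by (auto simp: successively_append_iff hd_append split: if_splits)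
            then show "closed_walk r ((Q @ S1 @ [s]) @ us)"
              using s(2) ne ends sQ closed_walk_append[of "Q @ S1 @ [s]" us r] by simp
          qed (use conf s in \<open>auto simp: absorption_def\<close>)
          then show ?thesis using less.hyps[of S2 "Q @ S1 @ [s]" Ls] shorter_us s by simp
        qed
      next
        case False
        then have noS: "\<not> r (last us) s \<and> \<not> r s (hd us)" if "s \<in> set S" for s using that by auto
        let ?ins = "\<lambda>s. insertable r Q Ls [s]"
        show ?thesis
        proof (cases "\<forall>s\<in>set S. ?ins s")
          case True
          from multi_insert[OF sQ(1) ne(1) Ls, where xss = "map (\<lambda>s. [s]) S"] sQ(2) True obtain Q' Ls' where
            Q': "successively r Q'" "Q' \<noteq> []" "hd Q' = hd Q" "last Q' = last Q" "length Q \<le> length Q'"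
            "\<forall>L\<in>set Ls'. closed_walk r L \<and> m \<le> length L" "length Ls' = length Ls"
            "mset (Q' @ concat Ls') = mset (Q @ concat Ls) + mset S" by auto
          show ?thesis
          proof (rule fin)
            show "closed_walk r (Q' @ us)" using Q' ne ends sQ by (simp add: closed_walk_append)
          qed (use Q' size3 \<open>m \<le> 3\<close> in auto)
        next
          case False
          then have "\<exists>s\<in>set S. \<not> ?ins s" by blast
          from split_list_first_prop[OF this] obtain S1 s R where
            s: "S = S1 @ s # R" "\<not> ?ins s" "\<And>y. y \<in> set S1 \<Longrightarrow> ?ins y" by blast
          have "\<exists>x\<in>set (s # R). \<not> ?ins x" using s(2) by simp
          from split_list_last_prop[OF this] obtain T0 t S2 where
            t: "s # R = T0 @ t # S2" "\<And>y. y \<in> set S2 \<Longrightarrow> ?ins y" by blast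
          \<comment> \<open>\<open>T\<close> is the shortest segment of \<open>S\<close> that
            contains all vertices without a slot; the vertices of \<open>S1\<close> and
            \<open>S2\<close> can be moved one at a time.\<close>
          define T where "T = T0 @ [t]"
          have ST: "S = S1 @ T @ S2" "T \<noteq> []" "hd T = s" "last T = t"
            using s t by (auto simp: T_def) (metis hd_append hd_Cons_tl list.sel(1) append_Nil)
          have T: "hd T \<in> set S" "last T \<in> set S" using ST by auto
          consider (pre) v where "v \<in> set us" "r v s" | (suf) v where "v \<in> set us" "r t v"
            | (none) "\<And>v. v \<in> set us \<Longrightarrow> \<not> r v (hd T) \<and> \<not> r (last T) v"
            using ST by blast
          then show ?thesis
          proof cases
            \<comment> \<open>After \<open>S1\<close> has been moved elsewhere, the path through
              \<open>Q'\<close>, \<open>U1\<close> and \<open>v\<close> closes with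
              \<open>T @ S2\<close>, and only the shorter path \<open>U2\<close> remains to be
              absorbed. It is nonempty because \<open>last us\<close> has no arc to
              \<open>S\<close>.\<close>
            case pre
            then obtain U1 U2 where us: "us = U1 @ v # U2" by (meson split_list)
            have "U2 \<noteq> []" using us pre noS[OF T(1)] ST by auto
            have "successively r S1" using sQ(2) ST by (auto simp: successively_append_iff)
            with multi_insert[OF sQ(1) ne(1) Ls, where xss = "map (\<lambda>s. [s]) S1"] s(3) obtain Q' Ls' where
              Q': "successively r Q'" "Q' \<noteq> []" "hd Q' = hd Q" "last Q' = last Q" "length Q \<le> length Q'"
              "\<forall>L\<in>set Ls'. closed_walk r L \<and> m \<le> length L" "length Ls' = length Ls"
              "mset (Q' @ concat Ls') = mset (Q @ concat Ls) + mset S1" by auto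
            have "absorption r m V (Q' @ U1 @ [v]) (T @ S2) U2 Ls'"
              unfolding absorption_def
            proof (intro conjI)
              have "hd (U1 @ [v]) = hd us" "last (T @ S2) = last S" "hd (T @ S2) = s" "last U2 = last us"
                using us ST \<open>U2 \<noteq> []\<close> by (auto simp: hd_append)
              moreover have "successively r (U1 @ [v])" "successively r U2" "r v (hd U2)" "successively r (T @ S2)"
                using sQ us ST \<open>U2 \<noteq> []\<close> by (auto simp: successively_append_iff successively_Cons)
              ultimately show "closed_walk r ((Q' @ U1 @ [v]) @ T @ S2)" "closed_walk r ((Q' @ U1 @ [v]) @ U2)"
                using closed_walk_append3[of Q' "U1 @ [v]" "T @ S2" r] closed_walk_append3[of Q' "U1 @ [v]" U2 r]
                  Q' ST(2,3) \<open>U2 \<noteq> []\<close> ends SQ pre(2) by simp_all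
              have "mset ((Q' @ U1 @ [v]) @ (T @ S2) @ U2 @ concat Ls') = mset (Q @ S @ us @ concat Ls)"
                using Q'(8) by (simp add: us ST(1))
              then show "distinct ((Q' @ U1 @ [v]) @ (T @ S2) @ U2 @ concat Ls')"
                "set ((Q' @ U1 @ [v]) @ (T @ S2) @ U2 @ concat Ls') = V"
                using dist V mset_eq_imp_distinct_iff mset_eq_setD by metis+
              show "3 \<le> length ((Q' @ U1 @ [v]) @ U2)" "m \<le> length ((Q' @ U1 @ [v]) @ T @ S2)"
                using Q'(2) \<open>U2 \<noteq> []\<close> ST(2) \<open>m \<le> 3\<close>
                by (cases Q'; cases U2; cases T; simp)+
            qed (use Q' \<open>U2 \<noteq> []\<close> in auto)
            from shorter_us[OF _ this] show ?thesis using us Q'(7) by simp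
          next
            \<comment> \<open>The mirror image: \<open>v\<close> starts the new kept path,
              \<open>S2\<close> is moved away, and \<open>U1\<close> remains to be absorbed.\<close>
            case suf
            then obtain U1 U2 where us: "us = U1 @ v # U2" by (meson split_list)
            have "U1 \<noteq> []" using us suf noS[OF T(2)] ST by auto
            have "successively r S2" using sQ(2) ST by (auto simp: successively_append_iff)
            with multi_insert[OF sQ(1) ne(1) Ls, where xss = "map (\<lambda>s. [s]) S2"] t(2) obtain Q' Ls' where
              Q': "successively r Q'" "Q' \<noteq> []" "hd Q' = hd Q" "last Q' = last Q" "length Q \<le> length Q'"
              "\<forall>L\<in>set Ls'. closed_walk r L \<and> m \<le> length L" "length Ls' = length Ls"
              "mset (Q' @ concat Ls') = mset (Q @ concat Ls) + mset S2" by auto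
            have "absorption r m V (v # U2 @ Q') (S1 @ T) U1 Ls'"
              unfolding absorption_def
            proof (intro conjI)
              have "hd U1 = hd us" "last (S1 @ T) = t" "hd (S1 @ T) = hd S" "last (v # U2) = last us"
                using us ST \<open>U1 \<noteq> []\<close> by (auto simp: hd_append)
              moreover have "successively r (v # U2)" "successively r U1" "r (last U1) v" "successively r (S1 @ T)"
                using sQ us ST \<open>U1 \<noteq> []\<close> by (auto simp: successively_append_iff successively_Cons)
              ultimately have "closed_walk r ((v # U2) @ Q' @ S1 @ T)" "closed_walk r ((v # U2) @ Q' @ U1)"
                using closed_walk_append3[of "v # U2" Q' "S1 @ T" r] closed_walk_append3[of "v # U2" Q' U1 r]
                  Q' ST(2,4) \<open>U1 \<noteq> []\<close> ends SQ suf(2) by simp_all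
              then show "closed_walk r ((v # U2 @ Q') @ S1 @ T)" "closed_walk r ((v # U2 @ Q') @ U1)"
                by simp_all
              have "mset ((v # U2 @ Q') @ (S1 @ T) @ U1 @ concat Ls') = mset (Q @ S @ us @ concat Ls)"
                using Q'(8) by (simp add: us ST(1))
              then show "distinct ((v # U2 @ Q') @ (S1 @ T) @ U1 @ concat Ls')"
                "set ((v # U2 @ Q') @ (S1 @ T) @ U1 @ concat Ls') = V"
                using dist V mset_eq_imp_distinct_iff mset_eq_setD by metis+
              show "3 \<le> length ((v # U2 @ Q') @ U1)" "m \<le> length ((v # U2 @ Q') @ S1 @ T)"
                using Q'(2) \<open>U1 \<noteq> []\<close> ST(2) \<open>m \<le> 3\<close>
                by (cases Q'; cases U1; cases T; simp)+
            qed (use Q' \<open>U1 \<noteq> []\<close> in auto)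
            from shorter_us[OF _ this] show ?thesis using us Q'(7) by simp
          next
            case none
            \<comment> \<open>Either \<open>us\<close> fits elsewhere and the cycle through
              \<open>S\<close> stays, or all of \<open>S\<close> fits elsewhere and
              \<open>us\<close> takes its place.\<close>
            from absorption_degree_sum[OF W irr dist V ne T noS none]
            show ?thesis
            proof
              assume "insertable r Q Ls us"
              then obtain w w' where "slot Q Ls w w'" "r w (hd us)" "r (last us) w'" by (auto simp: insertable_def)
              from slot_insert[OF sQ(1) ne(1) Ls this(1) ne(2) sQ(3) this(2,3)] obtain Q' Ls' where
                Q': "successively r Q'" "Q' \<noteq> []" "hd Q' = hd Q" "last Q' = last Q" "length Q \<le> length Q'"
                "\<forall>L\<in>set Ls'. closed_walk r L \<and> m \<le> length L" "length Ls' = length Ls"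
                "mset (Q' @ concat Ls') = mset (Q @ concat Ls) + mset us" by metis
              show ?thesis
              proof (rule fin)
                show "closed_walk r (Q' @ S)" using Q' S SQ sQ by (simp add: closed_walk_append)
              qed (use Q' sizem in auto)
            next
              assume insT: "insertable r Q Ls T"
              let ?xss = "map (\<lambda>s. [s]) S1 @ [T] @ map (\<lambda>s. [s]) S2"
              have parts: "xs \<noteq> [] \<and> insertable r Q Ls xs" if "xs \<in> set ?xss" for xs
                using that insT ST(2) s(3) t(2) by auto
              have S: "concat ?xss = S" using ST(1) by simp
              obtain Q' Ls' where
                Q': "successively r Q'" "Q' \<noteq> []" "hd Q' = hd Q" "last Q' = last Q" "length Q \<le> length Q'"
                "\<forall>L\<in>set Ls'. closed_walk r L \<and> m \<le> length L" "length Ls' = length Ls"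
                "mset (Q' @ concat Ls') = mset (Q @ concat Ls) + mset S"
                using multi_insert[OF sQ(1) ne(1) Ls, where xss = ?xss, unfolded S, OF sQ(2) parts] by blast
              show ?thesis
              proof (rule fin)
                show "closed_walk r (Q' @ us)" using Q' ne ends sQ by (simp add: closed_walk_append)
              qed (use Q' size3 \<open>m \<le> 3\<close> in auto)
            qed
          qed
        qed
      qed
    qed
  qed
qed

subsection \<open>Maximal packings and Woodall's theorem\<close>

lemma rtranclp_path:
  assumes "(\<lambda>a b. r a b \<and> a \<in> H \<and> b \<in> H)\<^sup>*\<^sup>* x y" "x \<in> H"
  obtains us where "us \<noteq> []" "hd us = x" "last us = y" "successively r us" "distinct us" "set us \<subseteq> H"
proof -
  have "\<exists>us. us \<noteq> [] \<and> hd us = x \<and> last us = y \<and> successively r us \<and> distinct us \<and> set us \<subseteq> H"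
    using assms(1)
  proof (induction rule: rtranclp_induct)
    case base
    show ?case by (rule exI[of _ "[x]"]) (use assms(2) in auto)
  next
    case (step y z)
    then obtain us where us: "us \<noteq> []" "hd us = x" "last us = y" "successively r us" "distinct us" "set us \<subseteq> H"
      by blast
    show ?case
    proof (cases "z \<in> set us")
      case True
      then obtain A B where "us = A @ z # B" by (meson split_list)
      then show ?thesis using us
        by (intro exI[of _ "A @ [z]"]) (auto simp: successively_append_iff hd_append)
    next
      case False
      then show ?thesis using us step(2)
        by (intro exI[of _ "us @ [z]"]) (auto simp: successively_append_iff)
    qed
  qed
  then show ?thesis using that by blast
qed

lemma closed_walk_rotate_gap:
  assumes "closed_walk r L" "cyc_gap L w w'"
  obtains L' where "closed_walk r L'" "mset L' = mset L" "hd L' = w'" "last L' = w"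
proof (cases "gap L w w'")
  case True
  then obtain A B where "L = A @ w # w' # B" by (auto simp: gap_def)
  then show ?thesis using that[of "(w' # B) @ A @ [w]"] closed_walk_rotate[of r "A @ [w]" "w' # B"] assms(1) by simp
next
  case False
  then show ?thesis using that[of L] assms by (auto simp: cyc_gap_def)
qed

lemma closed_walk_rotate_to:
  assumes "closed_walk r L" "x \<in> set L"
  obtains L' where "closed_walk r L'" "mset L' = mset L" "hd L' = x"
proof -
  obtain A B where "L = A @ x # B" using assms(2) by (meson split_list)
  then show ?thesis using that[of "(x # B) @ A"] closed_walk_rotate[of r A "x # B"] assms(1) by simp
qed

lemma degree_sum_gap:
  assumes "length (concat Ls) < indeg r (set (concat Ls)) u + outdeg r (set (concat Ls)) v" "distinct (concat Ls)"
  obtains L w w' where "L \<in> set Ls" "cyc_gap L w w'" "r w u" "r v w'"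
proof -
  obtain L where L: "L \<in> set Ls" "\<not> indeg r (set L) u + outdeg r (set L) v \<le> length L"
    using concat_degree_sum[of Ls r u v] assms(1) by fastforce
  moreover have "distinct L" using L(1) assms(2) by (auto simp: distinct_concat_iff)
  ultimately obtain w w' where "cyc_gap L w w'" "r w u \<and> r v w'" using cycle_degree_sum by metis
  then show ?thesis using that L(1) by blast
qed

lemma closed_walk_mset_length: "mset L = mset L' \<Longrightarrow> set L = set L' \<and> length L = length L' \<and> distinct L = distinct L'"
  by (metis mset_eq_imp_distinct_iff mset_eq_length mset_eq_setD)

section \<open>Packings of maximal total length that miss some vertices\<close>

locale maximal_packing =
  fixes r :: "'a \<Rightarrow> 'a \<Rightarrow> bool" and m :: nat and V :: "'a set" and Cs :: "'a list list"
  assumes fin: "finite V" and W: "woodall r V" and irr: "\<not> r x x" and m3: "m \<le> 3"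
    and Cs: "\<forall>C\<in>set Cs. closed_walk r C \<and> m \<le> length C" "distinct (concat Cs)" "set (concat Cs) \<subset> V"
    and max: "length Cs' = length Cs \<Longrightarrow> \<forall>C\<in>set Cs'. closed_walk r C \<and> m \<le> length C \<Longrightarrow>
      distinct (concat Cs') \<Longrightarrow> set (concat Cs') \<subseteq> V \<Longrightarrow> length (concat Cs') \<le> length (concat Cs)"
begin

abbreviation "U \<equiv> set (concat Cs)"
definition "H = V - U"

lemma H: "H \<noteq> {}" "finite H" "V = U \<union> H" "U \<inter> H = {}" "card V = length (concat Cs) + card H"
  using Cs fin distinct_card[OF Cs(2)] card_Un_disjoint[of U H] by (auto simp: H_def Un_absorb1)

lemma not_partition: "\<not> cycle_partition r m (length Cs) V"
proof
  assume "cycle_partition r m (length Cs) V"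
  then obtain Cs' where Cs': "length Cs' = length Cs" "\<forall>C\<in>set Cs'. closed_walk r C \<and> m \<le> length C"
    "distinct (concat Cs')" "set (concat Cs') = V" by (auto simp: cycle_partition_def)
  then have "card V \<le> length (concat Cs)" using max distinct_card by (metis order_refl)
  then show False using H(1,2,5) by auto
qed

text \<open>This is maximality, but for any rearrangement \<open>Ds\<close> of the packing on the
  same vertices, so that cycles may be rotated before a gap is chosen.\<close>

lemma no_insertion:
  assumes "length Ds = length Cs" "\<forall>C\<in>set Ds. closed_walk r C \<and> m \<le> length C" "mset (concat Ds) = mset (concat Cs)"
    and us: "us \<noteq> []" "successively r us" "distinct us" "set us \<subseteq> H"
    and L: "L \<in> set Ds" "cyc_gap L w w'" "r w (hd us)" "r (last us) w'"
  shows False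
proof -
  obtain X Y where Ds: "Ds = X @ L # Y" using L(1) by (meson split_list)
  obtain L' where L': "closed_walk r L'" "mset L' = mset L + mset us"
    using cyc_gap_insert[of r L w w' us] assms(2) L us by metis
  have len: "length L' = length L + length us" using arg_cong[OF L'(2), of size] by simp
  let ?Ds = "X @ L' # Y"
  have ms: "mset (concat ?Ds) = mset (concat Cs @ us)" using assms(3) L' by (simp add: Ds)
  have "distinct (concat Cs @ us)" "set (concat Cs @ us) \<subseteq> V" using Cs us H by auto
  then have "distinct (concat ?Ds)" "set (concat ?Ds) \<subseteq> V" "length (concat ?Ds) = length (concat Cs @ us)"
    using closed_walk_mset_length[OF ms] by simp_all
  moreover have "\<forall>C\<in>set ?Ds. closed_walk r C \<and> m \<le> length C" using assms(2) L' len by (auto simp: Ds)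
  moreover have "length ?Ds = length Cs" using assms(1) by (simp add: Ds)
  ultimately have "length (concat Cs @ us) \<le> length (concat Cs)" using max[of ?Ds] by simp
  then show False using us by simp
qed

lemma path_degree:
  assumes "us \<noteq> []" "successively r us" "distinct us" "set us \<subseteq> H"
  shows "indeg r U (hd us) + outdeg r U (last us) \<le> length (concat Cs)"
proof (rule ccontr)
  assume "\<not> ?thesis"
  then obtain L w w' where "L \<in> set Cs" "cyc_gap L w w'" "r w (hd us)" "r (last us) w'"
    using degree_sum_gap[OF _ Cs(2)] by (metis not_le)
  then show False using no_insertion[OF _ Cs(1)] assms by blast
qed

lemma degree_split: "indeg r V x \<le> indeg r U x + indeg r H x" "outdeg r V x \<le> outdeg r U x + outdeg r H x"
  using indeg_Un[of U H r x] outdeg_Un[of U H r x] H(2,3) by auto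

text \<open>A path inside \<open>H\<close> from \<open>v\<close> to \<open>u\<close> cannot be
  inserted into a cycle, so at most \<open>length (concat Cs)\<close> of the degree sum goes to
  \<open>U\<close> and the rest lies in \<open>H\<close>. Without such a path the condition for the
  non-arc from \<open>v\<close> to \<open>u\<close> is used as well. The set \<open>S\<close> of
  vertices reachable from \<open>v\<close> and its complement bound the degrees of that pair inside
  \<open>H\<close> by \<open>card H - 2\<close> in total, so both pairs have more than
  \<open>length (concat Cs)\<close> arcs to and from \<open>U\<close>; but neither \<open>u\<close>
  nor \<open>v\<close> alone can be inserted.\<close>

lemma woodall_H: "woodall r H"
  unfolding woodall_def
proof (intro ballI impI, rule ccontr)
  fix u v assume uv: "u \<in> H" "v \<in> H" "u \<noteq> v" "\<not> r u v" and "\<not> card H \<le> outdeg r H u + indeg r H v"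
  moreover have "card V \<le> outdeg r V u + indeg r V v" using uv H(3) by (intro woodallD[OF W]) auto
  ultimately have big: "length (concat Cs) < indeg r U v + outdeg r U u"
    using degree_split(1)[of v] degree_split(2)[of u] H(5) by linarith
  let ?R = "\<lambda>a b. r a b \<and> a \<in> H \<and> b \<in> H"
  define S where "S = {x. ?R\<^sup>*\<^sup>* v x}"
  have "u \<notin> S"
  proof
    assume "u \<in> S"
    then have "?R\<^sup>*\<^sup>* v u" by (simp add: S_def)
    from rtranclp_path[OF this uv(2)] path_degree big show False by (metis not_le)
  qed
  have S: "v \<in> S" "S \<subseteq> H" unfolding S_def using uv(2) by (auto elim: rtranclp.cases)
  have closed: "\<not> r x y" if "x \<in> S" "y \<in> H - S" for x y
    using that S(2) rtranclp.rtrancl_into_rtrancl[of ?R v x y] by (auto simp: S_def)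
  have "\<not> r v u" using closed[of v u] S uv(1) \<open>u \<notin> S\<close> by blast
  then have "card V \<le> outdeg r V v + indeg r V u" using uv H(3) by (intro woodallD[OF W]) auto
  moreover have "outdeg r H v < card S"
  proof -
    have "{y \<in> H. r v y} \<subseteq> S - {v}" using closed[OF S(1)] irr by auto
    then have "outdeg r H v \<le> card (S - {v})"
      unfolding outdeg_def using S(2) H(2) finite_subset by (intro card_mono) auto
    then show ?thesis using S H(2) card_Diff1_less[of S v] finite_subset by fastforce
  qed
  moreover have "indeg r H u < card (H - S)"
  proof -
    have "{y \<in> H. r y u} \<subseteq> (H - S) - {u}" using closed[of _ u] \<open>u \<notin> S\<close> uv(1) irr by auto
    then have "indeg r H u \<le> card ((H - S) - {u})"
      unfolding indeg_def using H(2) by (intro card_mono) auto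
    then show ?thesis using \<open>u \<notin> S\<close> uv(1) H(2) card_Diff1_less[of "H - S" u] by fastforce
  qed
  moreover have "card S + card (H - S) = card H" using S(2) H(2) by (metis card_Diff_subset card_mono finite_subset le_add_diff_inverse)
  moreover have "indeg r U v + outdeg r U v \<le> length (concat Cs)" "indeg r U u + outdeg r U u \<le> length (concat Cs)"
    using path_degree[of "[v]"] path_degree[of "[u]"] uv by simp_all
  ultimately show False using big degree_split(1)[of u] degree_split(2)[of v] H(5) by linarith
qed

text \<open>Otherwise a vertex of \<open>H\<close> and one of \<open>U\<close> form a non-arc whose
  degrees are confined to \<open>H\<close> and to \<open>U\<close>, together at most
  \<open>card V - 2\<close>.\<close>

lemma exit_arc:
  assumes "Cs \<noteq> []"
  shows "\<exists>h\<in>H. \<exists>y\<in>U. r h y"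
proof (rule ccontr)
  assume "\<not> ?thesis"
  then have no: "\<not> r h y" if "h \<in> H" "y \<in> U" for h y using that by blast
  obtain h where h: "h \<in> H" using H(1) by blast
  have "concat Cs \<noteq> []" using assms Cs(1) by (cases Cs) (auto simp: closed_walk_def)
  then obtain c where c: "c \<in> U" by (meson hd_in_set)
  have "card V \<le> outdeg r V h + indeg r V c"
    using no[OF h c] h c H(3,4) by (intro woodallD[OF W]) auto
  moreover have "outdeg r U h = 0" "indeg r H c = 0" using no h c by (auto intro: outdeg_eq_0 indeg_eq_0)
  moreover have "outdeg r H h < card H" using outdeg_less_card[OF H(2) h] irr by blast
  moreover have "indeg r U c < length (concat Cs)"
    using indeg_less_card[of U c r c] irr c distinct_card[OF Cs(2)] by simp
  ultimately show False using degree_split(1)[of c] degree_split(2)[of h] H(5) by linarith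
qed

text \<open>A path through all of \<open>H\<close> enters a cycle \<open>C'\<close> at
  \<open>y\<close> and goes round to the predecessor \<open>d\<close> of \<open>y\<close>. The
  degree condition for \<open>d\<close> and the start of the path yields a second cycle, through
  which the way from \<open>d\<close> leads back to the start. Both cycles and \<open>H\<close>
  become one cycle.\<close>

lemma merge_with_rest:
  assumes "Cs \<noteq> []" and ham: "set us = H" "distinct us" "successively r us" "length us = 1 \<or> r (last us) (hd us)"
  shows "cycle_partition r m (length Cs - 1) V"
proof -
  obtain h y where hy: "h \<in> H" "y \<in> U" "r h y" using exit_arc[OF assms(1)] by blast
  obtain us' where us': "set us' = H" "distinct us'" "successively r us'" "last us' = h" "us' \<noteq> []"
  proof -
    obtain A B where AB: "us = A @ h # B" using hy(1) ham(1) by (metis split_list)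
    show ?thesis
    proof (cases "length us = 1")
      case True
      then show ?thesis using that[of us] ham AB by auto
    next
      case False
      then have "closed_walk r us" using ham H(1) by (auto simp: closed_walk_def)
      then have "closed_walk r (B @ A @ [h])" using closed_walk_rotate[of r "A @ [h]" B] by (simp add: AB)
      then show ?thesis using that[of "B @ A @ [h]"] ham AB by (auto simp: closed_walk_def)
    qed
  qed
  let ?h = "hd us'"
  obtain C where C: "C \<in> set Cs" "y \<in> set C" using hy(2) by auto
  obtain X Y where XY: "Cs = X @ C # Y" using C(1) by (meson split_list)
  obtain C' where C': "closed_walk r C'" "mset C' = mset C" "hd C' = y"
    using closed_walk_rotate_to[of r C y] C Cs(1) by metis
  define Ls where "Ls = X @ Y"
  define d where "d = last C'"
  have C'ne: "C' \<noteq> []" using C'(1) by (simp add: closed_walk_def)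
  have Ls: "\<forall>L\<in>set (C' # Ls). closed_walk r L \<and> m \<le> length L"
    using Cs(1) C'(1) closed_walk_mset_length[OF C'(2)] by (auto simp: Ls_def XY)
  have ms: "mset (concat (C' # Ls)) = mset (concat Cs)" using C'(2) by (simp add: Ls_def XY)
  have len: "length (C' # Ls) = length Cs" by (simp add: Ls_def XY)
  have dU: "distinct (C' @ concat Ls)" "U = set C' \<union> set (concat Ls)" "length (concat Cs) = length C' + length (concat Ls)"
    using closed_walk_mset_length[OF ms] Cs(2) by auto
  \<comment> \<open>Otherwise the final part of the path, from \<open>g\<close> to \<open>h\<close>,
    fits between \<open>d\<close> and \<open>y\<close>, against maximality.\<close>
  have no_d: "\<not> r d g" if g: "g \<in> H" for g
  proof
    assume "r d g"
    obtain U1 U2 where U: "us' = U1 @ g # U2" using g us'(1) by (metis split_list)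
    have "cyc_gap C' d y" using C'(3) C'ne by (auto simp: cyc_gap_def d_def)
    moreover have "last (g # U2) = h" "successively r (g # U2)" using us'(3,4) U by (auto simp: successively_append_iff)
    moreover have "distinct (g # U2)" "set (g # U2) \<subseteq> H" using us'(1,2) U by auto
    ultimately show False
      using no_insertion[OF len Ls ms, of "g # U2" C' d y] \<open>r d g\<close> hy(3) by simp
  qed
  \<comment> \<open>An in-neighbour other than \<open>y\<close> would let \<open>C'\<close> absorb
    the path, and the same number of cycles would cover \<open>V\<close>. For \<open>y\<close>
    itself the cycle through \<open>y\<close> and \<open>us'\<close> may have only two vertices,
    hence the bound 1 and not 0.\<close>
  have in_C: "indeg r (set C') ?h \<le> 1"
  proof -
    have "a = y" if a: "a \<in> set C'" "r a ?h" for a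
    proof (rule ccontr)
      assume "a \<noteq> y"
      obtain Q0 S where Q: "C' = Q0 @ a # S" using a(1) by (meson split_list)
      have "Q0 \<noteq> []" using Q C'(3) \<open>a \<noteq> y\<close> by (cases Q0) auto
      have "absorption r m V (Q0 @ [a]) S us' Ls"
        unfolding absorption_def
      proof (intro conjI)
        have "successively r (Q0 @ [a])" "hd (Q0 @ [a]) = y"
          using C'(1,3) Q \<open>Q0 \<noteq> []\<close> by (auto simp: closed_walk_def successively_append_iff)
        then show "closed_walk r ((Q0 @ [a]) @ us')"
          using closed_walk_append[of "Q0 @ [a]" us' r] us' a(2) hy(3) by simp
        show "closed_walk r ((Q0 @ [a]) @ S)" using C'(1) Q by simp
        show "distinct ((Q0 @ [a]) @ S @ us' @ concat Ls)" "set ((Q0 @ [a]) @ S @ us' @ concat Ls) = V"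
          using dU us' H(3,4) Q by auto
        show "3 \<le> length ((Q0 @ [a]) @ us')" using \<open>Q0 \<noteq> []\<close> us'(5) by (cases Q0; cases us'; simp)
      qed (use Ls Q us'(5) in auto)
      from absorption_cycle_partition[OF W irr m3 this] len show False using not_partition by simp
    qed
    then have "{a \<in> set C'. r a ?h} \<subseteq> {y}" by auto
    from card_mono[OF _ this] show ?thesis by (simp add: indeg_def)
  qed
  have hH: "?h \<in> H" unfolding us'(1)[symmetric] using us'(5) by (rule hd_in_set)
  have dC: "d \<in> set C'" using C'ne by (simp add: d_def)
  have "card V \<le> outdeg r V d + indeg r V ?h"
  proof (intro woodallD[OF W])
    show "d \<in> V" "?h \<in> V" "d \<noteq> ?h" using hH dC dU(2) H(3,4) by blast+
  qed (rule no_d[OF hH])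
  moreover have "outdeg r H d = 0" using no_d by (auto intro: outdeg_eq_0)
  moreover have "outdeg r (set C') d < length C'"
    using outdeg_less_card[of "set C'" d r d] dC irr dU(1) by (simp add: distinct_card)
  moreover have "indeg r H ?h < card H" using indeg_less_card[OF H(2) hH] irr by blast
  moreover have "indeg r U ?h \<le> indeg r (set C') ?h + indeg r (set (concat Ls)) ?h"
    "outdeg r U d \<le> outdeg r (set C') d + outdeg r (set (concat Ls)) d"
    unfolding dU(2) by (rule indeg_Un outdeg_Un; simp)+
  ultimately have "length (concat Ls) < indeg r (set (concat Ls)) ?h + outdeg r (set (concat Ls)) d"
    using degree_split(1)[of ?h] degree_split(2)[of d] in_C H(5) dU(3) by linarith
  then obtain L w w' where L: "L \<in> set Ls" "cyc_gap L w w'" "r w ?h" "r d w'"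
    using degree_sum_gap[of Ls r ?h d] dU(1) by auto
  have "closed_walk r L" using Ls L(1) by simp
  from closed_walk_rotate_gap[OF this L(2)] obtain L' where
    L': "closed_walk r L'" "mset L' = mset L" "hd L' = w'" "last L' = w" by blast
  have L'ne: "L' \<noteq> []" using L'(1) by (simp add: closed_walk_def)
  obtain X' Y' where XY': "Ls = X' @ L # Y'" using L(1) by (meson split_list)
  let ?D = "us' @ C' @ L'"
  show ?thesis
  proof (rule cycle_partitionI[of "?D # X' @ Y'"])
    have "closed_walk r ?D"
      using closed_walk_append3[of us' C' L' r] us' C' L' C'ne L'ne L(3,4) hy(3)
      by (simp add: closed_walk_def d_def)
    moreover have "0 < length us'" "0 < length C'" "0 < length L'" using us'(5) C'ne L'ne by auto
    then have "m \<le> length ?D" unfolding length_append using m3 by linarith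
    ultimately show "closed_walk r C \<and> m \<le> length C" if "C \<in> set (?D # X' @ Y')" for C
      using that Ls by (auto simp: XY')
    show "mset (concat (?D # X' @ Y')) = mset (us' @ C' @ concat Ls)" by (simp add: XY' L'(2))
    show "distinct (us' @ C' @ concat Ls)" "set (us' @ C' @ concat Ls) = V"
      using us' dU H(3,4) by auto
    show "length (?D # X' @ Y') = length Cs - 1" using len by (simp add: XY')
  qed
qed

end

section \<open>Existence of maximal packings, and Woodall's theorem\<close>

definition packing :: "('a \<Rightarrow> 'a \<Rightarrow> bool) \<Rightarrow> nat \<Rightarrow> 'a set \<Rightarrow> 'a list list \<Rightarrow> bool" where
  "packing r m V Cs \<longleftrightarrow> (\<forall>C\<in>set Cs. closed_walk r C \<and> m \<le> length C) \<and> distinct (concat Cs) \<and> set (concat Cs) \<subseteq> V"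

lemma packing_length_le: "finite V \<Longrightarrow> packing r m V Cs \<Longrightarrow> length (concat Cs) \<le> card V"
  unfolding packing_def by (metis card_mono distinct_card)

lemma maximal_packing_exists:
  assumes "finite V" "packing r m V Cs0"
  obtains Cs where "packing r m V Cs" "length Cs = length Cs0"
    "\<And>Cs'. packing r m V Cs' \<Longrightarrow> length Cs' = length Cs0 \<Longrightarrow> length (concat Cs') \<le> length (concat Cs)"
proof -
  let ?P = "\<lambda>Cs. packing r m V Cs \<and> length Cs = length Cs0"
  have "?P Cs0" using assms(2) by simp
  moreover have "\<forall>Cs. ?P Cs \<longrightarrow> length (concat Cs) < Suc (card V)"
    using packing_length_le[OF assms(1)] less_Suc_eq_le by blast
  ultimately obtain Cs where "?P Cs" "\<And>Cs'. ?P Cs' \<Longrightarrow> length (concat Cs') \<le> length (concat Cs)"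
    using ex_has_greatest_nat[of ?P Cs0 "\<lambda>Cs. length (concat Cs)" "Suc (card V)"] by blast
  then show ?thesis using that by blast
qed

lemma maximal_packingI:
  assumes "finite V" "woodall r V" "\<And>x. \<not> r x x" "m \<le> 3" "packing r m V Cs" "set (concat Cs) \<noteq> V"
    and "\<And>Cs'. packing r m V Cs' \<Longrightarrow> length Cs' = length Cs \<Longrightarrow> length (concat Cs') \<le> length (concat Cs)"
  shows "maximal_packing r m V Cs"
  using assms unfolding maximal_packing_def packing_def by (metis psubsetI)

text \<open>Every vertex has an out-neighbour by the degree condition, and an out-neighbour of the
  end of a longest path lies on that path.\<close>

lemma closed_walk_exists:
  assumes fin: "finite V" and W: "woodall r V" and irr: "\<And>x. \<not> r x x" and "1 < card V"
  obtains C where "closed_walk r C" "distinct C" "set C \<subseteq> V"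
proof -
  have out: "\<exists>w\<in>V. r v w" if v: "v \<in> V" for v
  proof (rule ccontr)
    assume no: "\<not> ?thesis"
    have "V \<noteq> {v}" using \<open>1 < card V\<close> by auto
    then obtain w where w: "w \<in> V" "w \<noteq> v" using v by blast
    have "card V \<le> outdeg r V v + indeg r V w" using no v w by (intro woodallD[OF W]) auto
    moreover have "outdeg r V v = 0" using no by (auto intro: outdeg_eq_0)
    moreover have "indeg r V w < card V" using indeg_less_card[OF fin w(1)] irr by blast
    ultimately show False by linarith
  qed
  let ?P = "\<lambda>us. us \<noteq> [] \<and> successively r us \<and> distinct us \<and> set us \<subseteq> V"
  obtain v where "v \<in> V" using \<open>1 < card V\<close> by (metis card.empty equals0I not_less_zero)
  then have "?P [v]" by simp
  moreover have "\<forall>us. ?P us \<longrightarrow> length us < Suc (card V)"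
    using fin by (metis card_mono distinct_card less_Suc_eq_le)
  ultimately obtain us where us: "?P us" "\<And>us'. ?P us' \<Longrightarrow> length us' \<le> length us"
    using ex_has_greatest_nat[of ?P "[v]" length "Suc (card V)"] by blast
  have "last us \<in> V" using us(1) last_in_set by blast
  then obtain w where w: "w \<in> V" "r (last us) w" using out by blast
  have "w \<in> set us"
  proof (rule ccontr)
    assume "w \<notin> set us"
    then have "?P (us @ [w])" using us(1) w by (auto simp: successively_append_iff)
    then show False using us(2)[of "us @ [w]"] by simp
  qed
  then obtain A B where AB: "us = A @ w # B" by (meson split_list)
  then have "last us = last (w # B)" by simp
  then have "closed_walk r (w # B)" using us(1) w(2) AB by (simp add: closed_walk_def successively_append_iff)
  then show ?thesis using that[of "w # B"] us(1) AB by simp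
qed

text \<open>Woodall's theorem. A single vertex counts as Hamiltonian here.\<close>
lemma woodall_hamiltonian:
  assumes "finite V" "V \<noteq> {}" "woodall r V" and irr: "\<And>x. \<not> r x x"
  shows "\<exists>us. set us = V \<and> distinct us \<and> successively r us \<and> (length us = 1 \<or> r (last us) (hd us))"
  using assms(1-3)
proof (induction "card V" arbitrary: V rule: less_induct)
  case less
  show ?case
  proof (cases "card V = 1")
    case True
    then obtain v where "V = {v}" by (rule card_1_singletonE)
    then show ?thesis by (intro exI[of _ "[v]"]) auto
  next
    case False
    then have "1 < card V" using less.prems(1,2) by (simp add: card_gt_0_iff nat_neq_iff)
    then obtain C where C: "closed_walk r C" "distinct C" "set C \<subseteq> V"
      using closed_walk_exists[OF less.prems(1,3) irr] by blast
    \<comment> \<open>A longest cycle is a maximal packing with one member; the lower bound 0 admits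
      cycles of length two.\<close>
    then have "packing r 0 V [C]" by (simp add: packing_def)
    then obtain Cs where Cs: "packing r 0 V Cs" "length Cs = 1"
      "\<And>Cs'. packing r 0 V Cs' \<Longrightarrow> length Cs' = 1 \<Longrightarrow> length (concat Cs') \<le> length (concat Cs)"
      using maximal_packing_exists[OF less.prems(1), of r 0 "[C]"] by auto
    then obtain D where D: "Cs = [D]" by (metis One_nat_def length_0_conv length_Suc_conv)
    show ?thesis
    proof (cases "set D = V")
      case True
      then show ?thesis using Cs(1) D by (auto simp: packing_def closed_walk_def)
    next
      case ne: False
      have max: "maximal_packing r 0 V Cs"
        using less.prems irr Cs ne D by (intro maximal_packingI) auto
      interpret maximal_packing r 0 V Cs by (rule max)
      have "D \<noteq> []" using Cs(1) D by (auto simp: packing_def closed_walk_def)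
      then have "card H < card V" using H(5) D by simp
      then obtain us where "set us = H" "distinct us" "successively r us" "length us = 1 \<or> r (last us) (hd us)"
        using less.hyps[of H] H(1,2) woodall_H by blast
      \<comment> \<open>There is no second cycle to merge with, so merging degenerates to a
        partition of the nonempty set \<open>V\<close> into zero cycles, a contradiction.\<close>
      then have "cycle_partition r 0 0 V" using merge_with_rest[of us] D by simp
      then show ?thesis using less.prems(2) by (auto simp: cycle_partition_def)
    qed
  qed
qed

lemma packing_cycle_partition:
  assumes fin: "finite V" and W: "woodall r V" and irr: "\<And>x. \<not> r x x" and m: "m \<le> 3"
    and Cs0: "packing r m V Cs0" "Cs0 \<noteq> []"
  shows "cycle_partition r m (length Cs0) V \<or> cycle_partition r m (length Cs0 - 1) V"
proof -
  obtain Cs where mx: "packing r m V Cs" "length Cs = length Cs0"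
    "\<And>Cs'. packing r m V Cs' \<Longrightarrow> length Cs' = length Cs0 \<Longrightarrow> length (concat Cs') \<le> length (concat Cs)"
    using maximal_packing_exists[OF fin Cs0(1)] by blast
  show ?thesis
  proof (cases "set (concat Cs) = V")
    case True
    then show ?thesis using mx(1,2) unfolding packing_def cycle_partition_def by blast
  next
    case False
    then have "maximal_packing r m V Cs"
      using assms mx by (intro maximal_packingI) auto
    then interpret maximal_packing r m V Cs .
    obtain us where us: "set us = H" "distinct us" "successively r us" "length us = 1 \<or> r (last us) (hd us)"
      using woodall_hamiltonian[OF H(2,1) woodall_H irr] by blast
    have "Cs \<noteq> []" using mx(2) Cs0(2) by (metis length_0_conv)
    from merge_with_rest[OF this us] mx(2) show ?thesis by simp
  qed
qed

subsection \<open>Arcs between the cycles of a partition\<close>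

definition spans :: "('a \<Rightarrow> 'a \<Rightarrow> bool) \<Rightarrow> 'a set \<Rightarrow> 'a list list \<Rightarrow> bool" where
  "spans r V Cs \<longleftrightarrow> (\<forall>C\<in>set Cs. closed_walk r C \<and> 3 \<le> length C) \<and> distinct (concat Cs) \<and> set (concat Cs) = V"

lemma spans_mset:
  assumes "spans r V Cs" "mset (concat Ds) = mset (concat Cs)" "\<And>D. D \<in> set Ds \<Longrightarrow> closed_walk r D \<and> 3 \<le> length D"
  shows "spans r V Ds"
  using assms closed_walk_mset_length[OF assms(2)] by (auto simp: spans_def)

lemma spans_replace:
  assumes "spans r V (C # Ls)" "mset D = mset C" "closed_walk r D"
  shows "spans r V (D # Ls)"
  using assms(1)
proof (rule spans_mset)
  show "closed_walk r X \<and> 3 \<le> length X" if "X \<in> set (D # Ls)" for X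
    using that assms closed_walk_mset_length[OF assms(2)] by (auto simp: spans_def)
qed (simp add: assms(2))

lemma spans_perm:
  assumes "spans r V Cs" "mset Ds = mset Cs"
  shows "spans r V Ds"
  using assms(1)
proof (rule spans_mset)
  show "mset (concat Ds) = mset (concat Cs)" using assms(2) by (metis mset_concat mset_map sum_mset_sum_list)
  show "closed_walk r D \<and> 3 \<le> length D" if "D \<in> set Ds" for D
    using that assms mset_eq_setD[OF assms(2)] by (auto simp: spans_def)
qed

locale stuck =
  fixes r :: "'a \<Rightarrow> 'a \<Rightarrow> bool" and V :: "'a set" and k :: nat
  assumes W: "woodall r V" and irr: "\<not> r x x" and stuck: "\<not> cycle_partition r 3 k V"
begin

lemma not_spans: "spans r V Cs \<Longrightarrow> length Cs \<noteq> k"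
  using stuck unfolding spans_def cycle_partition_def by blast

lemma not_absorption: "Suc (length Ls) = k \<Longrightarrow> \<not> absorption r 3 V Q S us Ls"
  using absorption_cycle_partition[OF W irr, of 3] stuck by auto

text \<open>With \<open>P\<close> in the role of the path, absorption would turn
  \<open>k + 1\<close> cycles into \<open>k\<close>. Since \<open>P\<close> may start at any of its
  vertices, a vertex of \<open>P\<close> that is entered from \<open>C\<close> has a predecessor on
  \<open>P\<close> without arcs to \<open>C\<close>.\<close>

lemma no_return:
  assumes sp: "spans r V (C # P # Ls)" and k: "Suc (length Ls) = k"
    and "x \<in> set C" "y \<in> set C" "r x (hd P)" "r (last P) y"
  shows False
proof -
  have C: "closed_walk r C" "closed_walk r P" "3 \<le> length C" "3 \<le> length P" "P \<noteq> []"
    using sp by (auto simp: spans_def)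
  obtain Q S where Q: "Q \<noteq> []" "hd Q = y" "last Q = x" "mset (Q @ S) = mset C" "closed_walk r (Q @ S)"
    using closed_walk_split[OF C(1) assms(3,4)] by blast
  have ms: "mset (concat ((Q @ S) # P # Ls)) = mset (Q @ S @ P @ concat Ls)" by simp
  have sp': "spans r V ((Q @ S) # P # Ls)" using spans_replace[OF sp Q(4,5)] .
  have "absorption r 3 V Q S P Ls"
    unfolding absorption_def
  proof (intro conjI)
    have "successively r Q" "successively r P" using Q(5) C(2) by (auto simp: closed_walk_def successively_append_iff)
    then show "closed_walk r (Q @ P)" using closed_walk_append[of Q P r] Q(1-3) C(5) assms(5,6) by simp
    show "3 \<le> length (Q @ S)" using closed_walk_mset_length[OF Q(4)] C(3) by simp
  qed (use sp' Q C in \<open>auto simp: spans_def\<close>)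
  then show False using not_absorption[OF k] by blast
qed

text \<open>The degree condition is added for the non-arcs from \<open>e\<close> to
  \<open>b'\<close> and from \<open>e'\<close> to \<open>b\<close>. All four degrees vanish in the
  opposite cycle and miss the vertex itself in its own; the degrees in \<open>Ls\<close> regroup
  into the pairs controlled by the assumption on gaps. So twice \<open>card V\<close> would be at
  most twice \<open>card V\<close> minus 4.\<close>

lemma two_ends:
  assumes sp: "spans r V (C # P # Ls)"
    and mem: "e \<in> set C" "b \<in> set C" "e' \<in> set P" "b' \<in> set P"
    and no: "\<And>p. p \<in> set P \<Longrightarrow> \<not> r e p \<and> \<not> r p b" "\<And>c. c \<in> set C \<Longrightarrow> \<not> r e' c \<and> \<not> r c b'"
    and L: "\<And>L w w'. L \<in> set Ls \<Longrightarrow> cyc_gap L w w' \<Longrightarrow> \<not> (r w b \<and> r e w') \<and> \<not> (r w b' \<and> r e' w')"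
  shows False
proof -
  let ?R = "set (concat Ls)"
  have V: "V = set C \<union> set P \<union> ?R" and dist: "distinct (C @ P @ concat Ls)"
    using sp by (auto simp: spans_def)
  have le: "indeg r V x \<le> indeg r (set C) x + indeg r (set P) x + indeg r ?R x"
    "outdeg r V x \<le> outdeg r (set C) x + outdeg r (set P) x + outdeg r ?R x" for x
    using indeg_Un[of "set C \<union> set P" ?R r x] indeg_Un[of "set C" "set P" r x]
      outdeg_Un[of "set C \<union> set P" ?R r x] outdeg_Un[of "set C" "set P" r x] by (auto simp: V)
  have "e \<noteq> b'" "e' \<noteq> b" using mem dist by auto
  then have "card V \<le> outdeg r V e + indeg r V b'" "card V \<le> outdeg r V e' + indeg r V b"
    using mem no V by (intro woodallD[OF W]; auto)+
  moreover have "outdeg r (set P) e = 0" "indeg r (set P) b = 0" "outdeg r (set C) e' = 0" "indeg r (set C) b' = 0"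
    using no by (auto intro!: outdeg_eq_0 indeg_eq_0)
  moreover have "outdeg r (set C) e < length C" "indeg r (set C) b < length C"
    "outdeg r (set P) e' < length P" "indeg r (set P) b' < length P"
    using outdeg_less_card[of "set C" e r e] indeg_less_card[of "set C" b r b]
      outdeg_less_card[of "set P" e' r e'] indeg_less_card[of "set P" b' r b'] mem irr dist
    by (auto simp: distinct_card)
  moreover have "indeg r ?R b + outdeg r ?R e \<le> length (concat Ls)" "indeg r ?R b' + outdeg r ?R e' \<le> length (concat Ls)"
    using L dist by (intro concat_degree_sum cycle_degree_sum; auto simp: distinct_concat_iff)+
  moreover have "card V = length C + length P + length (concat Ls)"
    using distinct_card[OF dist] V by (simp add: Un_assoc)
  ultimately show False using le(1)[of b] le(1)[of b'] le(2)[of e] le(2)[of e'] by linarith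
qed

text \<open>Once \<open>S\<close> is inserted into \<open>L\<close>, the two arcs make
  \<open>B @ A\<close> a cycle and \<open>T\<close> is a path attached to both ends of
  \<open>B\<close>; absorption then reaches \<open>k\<close> cycles.\<close>

lemma not_movable:
  assumes sp: "spans r V ((A @ S) # (B @ T) # Ls)" and k: "Suc (length Ls) = k"
    and ne: "A \<noteq> []" "S \<noteq> []" "B \<noteq> []" "T \<noteq> []" and AB: "r (last A) (hd B)" "r (last B) (hd A)" "3 \<le> length (A @ B)"
    and L: "L \<in> set Ls" "cyc_gap L w w'" "r w (hd S)" "r (last S) w'"
  shows False
proof -
  have cl: "closed_walk r (A @ S)" "closed_walk r (B @ T)" "3 \<le> length (B @ T)" "closed_walk r L" "3 \<le> length L"
    using sp L(1) by (auto simp: spans_def)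
  have su: "successively r A" "successively r S" "successively r B"
    using cl(1,2) by (auto simp: closed_walk_def successively_append_iff)
  obtain X Y where XY: "Ls = X @ L # Y" using L(1) by (meson split_list)
  obtain L' where L': "closed_walk r L'" "mset L' = mset L + mset S"
    using cyc_gap_insert[OF cl(4) L(2) ne(2) su(2) L(3,4)] by metis
  have len: "length L' = length L + length S" using arg_cong[OF L'(2), of size] by simp
  have BA: "closed_walk r (B @ A)" using closed_walk_append[of B A r] ne AB su by simp
  let ?Ls = "X @ L' # Y"
  have ms: "mset (B @ A @ T @ concat ?Ls) = mset (concat ((A @ S) # (B @ T) # Ls))"
    by (simp add: XY L'(2))
  have "absorption r 3 V B A T ?Ls"
    unfolding absorption_def
  proof (intro conjI)
    show "distinct (B @ A @ T @ concat ?Ls)" "set (B @ A @ T @ concat ?Ls) = V"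
      using closed_walk_mset_length[OF ms] sp by (simp_all add: spans_def)
    show "\<forall>L\<in>set ?Ls. closed_walk r L \<and> 3 \<le> length L" using sp L'(1) len cl(5) by (auto simp: spans_def XY)
  qed (use ne AB cl BA in auto)
  then show False using not_absorption[of ?Ls] k by (simp add: XY)
qed

text \<open>The segment \<open>A\<close> of \<open>C\<close> from \<open>x'\<close> to
  \<open>x\<close> and the segment \<open>B\<close> of \<open>P\<close> from \<open>y\<close> to
  \<open>y'\<close> together form a cycle. By \<open>no_return\<close>, no arc leads from the last
  vertex of a complementary segment \<open>S\<close> or \<open>T\<close> to the opposite cycle, nor
  from there to its first vertex; by \<open>not_movable\<close>, neither segment fits into another
  cycle. This contradicts \<open>two_ends\<close>. The exception is the case where
  \<open>A @ B\<close> has only two vertices.\<close>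

lemma two_way_arcs:
  assumes sp: "spans r V (C # P # Ls)" and k: "Suc (length Ls) = k"
    and mem: "x \<in> set C" "y \<in> set P" "r x y" "x' \<in> set C" "y' \<in> set P" "r y' x'"
  shows "x = x' \<and> y = y'"
proof (rule ccontr)
  assume neq: "\<not> ?thesis"
  have C: "closed_walk r C" "closed_walk r P" using sp by (auto simp: spans_def)
  obtain A S where A: "A \<noteq> []" "hd A = x'" "last A = x" "mset (A @ S) = mset C" "closed_walk r (A @ S)"
    using closed_walk_split[OF C(1) mem(1,4)] by blast
  obtain B T where B: "B \<noteq> []" "hd B = y" "last B = y'" "mset (B @ T) = mset P" "closed_walk r (B @ T)"
    using closed_walk_split[OF C(2) mem(5,2)] by blast
  have len: "3 \<le> length (A @ B)"
    using neq A(1-3) B(1-3) by (cases A; cases B) (auto simp: Suc_le_eq neq_Nil_conv split: if_splits)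
  have "spans r V (P # (A @ S) # Ls)" by (rule spans_perm[OF spans_replace[OF sp A(4,5)]]) simp
  then have sp2: "spans r V ((B @ T) # (A @ S) # Ls)" by (rule spans_replace[OF _ B(4,5)])
  then have sp1: "spans r V ((A @ S) # (B @ T) # Ls)" by (rule spans_perm) simp
  have rot: "closed_walk r (S @ A)" "closed_walk r (T @ B)" using A(5) B(5) closed_walk_rotate by blast+
  have sp3: "spans r V ((B @ T) # (S @ A) # Ls)"
    using spans_perm[OF spans_replace[OF sp1, of "S @ A"], of "(B @ T) # (S @ A) # Ls"] rot by simp
  have sp4: "spans r V ((A @ S) # (T @ B) # Ls)"
    using spans_perm[OF spans_replace[OF sp2, of "T @ B"], of "(A @ S) # (T @ B) # Ls"] rot by simp
  have mem': "x \<in> set (A @ S)" "x' \<in> set (A @ S)" "y \<in> set (B @ T)" "y' \<in> set (B @ T)"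
    using mem mset_eq_setD[OF A(4)] mset_eq_setD[OF B(4)] by auto
  have S: "S \<noteq> []" using no_return[OF sp2 k mem'(4,3)] A mem by auto
  have T: "T \<noteq> []" using no_return[OF sp1 k mem'(1,2)] B mem by auto
  show False
  proof (rule two_ends[OF sp1])
    show "last S \<in> set (A @ S)" "hd S \<in> set (A @ S)" "last T \<in> set (B @ T)" "hd T \<in> set (B @ T)"
      using S T by auto
    show "\<not> r (last S) p \<and> \<not> r p (hd S)" if p: "p \<in> set (B @ T)" for p
      using no_return[OF sp2 k mem'(4) p] no_return[OF sp3 k p mem'(3)] A S mem by auto
    show "\<not> r (last T) c \<and> \<not> r c (hd T)" if c: "c \<in> set (A @ S)" for c
      using no_return[OF sp1 k mem'(1) c] no_return[OF sp4 k c mem'(2)] B T mem by auto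
    show "\<not> (r w (hd S) \<and> r (last S) w') \<and> \<not> (r w (hd T) \<and> r (last T) w')"
      if "L \<in> set Ls" "cyc_gap L w w'" for L w w'
      using not_movable[OF sp1 k A(1) S B(1) T _ _ len that] not_movable[OF sp2 k B(1) T A(1) S _ _ _ that]
        A B mem len by (auto simp: add.commute)
  qed
qed

text \<open>By the previous lemma all arcs between the two cycles would join the same two vertices;
  then the two successors of each of these vertices violate the degree condition.\<close>
lemma one_way:
  assumes sp: "spans r V (C # P # Ls)" and k: "Suc (length Ls) = k"
    and mem: "x \<in> set C" "y \<in> set P" "r x y" "x' \<in> set C" "y' \<in> set P" "r y' x'"
  shows False
proof -
  have eq: "x' = x" "y' = y" using two_way_arcs[OF sp k mem] by auto
  have only: "c = x \<and> p = y" if "c \<in> set C" "p \<in> set P" "r c p \<or> r p c" for c p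
    using two_way_arcs[OF sp k that(1,2) _ mem(4-6)] two_way_arcs[OF sp k mem(1-3) that(1,2)] that(3) eq by blast
  have C: "closed_walk r C" "closed_walk r P" using sp by (auto simp: spans_def)
  obtain C' where C': "closed_walk r C'" "mset C' = mset C" "hd C' = x" using closed_walk_rotate_to[OF C(1) mem(1)] .
  obtain P' where P': "closed_walk r P'" "mset P' = mset P" "hd P' = y" using closed_walk_rotate_to[OF C(2) mem(2)] .
  have "spans r V (P # C' # Ls)" by (rule spans_perm[OF spans_replace[OF sp C'(2,1)]]) simp
  then have sp2: "spans r V (P' # C' # Ls)" by (rule spans_replace[OF _ P'(2,1)])
  then have sp1: "spans r V (C' # P' # Ls)" by (rule spans_perm) simp
  have three: "\<exists>s t X. D = hd D # s # t # X" if "3 \<le> length D" for D :: "'a list"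
    using that by (metis Suc_le_length_iff list.sel(1) numeral_3_eq_3)
  have "3 \<le> length C'" "3 \<le> length P'" using sp1 by (auto simp: spans_def)
  then obtain s1 s2 X t1 t2 Y where CP: "C' = x # s1 # s2 # X" "P' = y # t1 # t2 # Y"
    using three[of C'] three[of P'] C'(3) P'(3) by auto
  have dist: "distinct C'" "distinct P'" using sp1 by (auto simp: spans_def)
  \<comment> \<open>As \<open>s\<close> precedes \<open>t\<close> on \<open>D\<close>, all of
    \<open>D\<close> is a path from \<open>t\<close> to \<open>s\<close> that would fit into the
    gap, which leaves \<open>k\<close> cycles.\<close>
  have no_move: False
    if spD: "spans r V (D # E # Ls)" and D: "D = u # s # t # Z" and L: "L \<in> set Ls" "cyc_gap L w w'" "r w t" "r s w'"
    for D E u s t Z L w w'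
  proof -
    have "closed_walk r ([u, s] @ t # Z)" "closed_walk r L" "3 \<le> length L" using spD L(1) by (auto simp: spans_def D)
    then have "closed_walk r ((t # Z) @ [u, s])" using closed_walk_rotate by blast
    then have su: "successively r ((t # Z) @ [u, s])" by (simp only: closed_walk_def)
    have he: "hd ((t # Z) @ [u, s]) = t" "last ((t # Z) @ [u, s]) = s" "(t # Z) @ [u, s] \<noteq> []" by auto
    obtain L' where L': "closed_walk r L'" "mset L' = mset L + mset ((t # Z) @ [u, s])"
      using cyc_gap_insert[OF \<open>closed_walk r L\<close> L(2) he(3) su] L(3,4) he(1,2) by metis
    have len: "length L' = length L + length ((t # Z) @ [u, s])" using arg_cong[OF L'(2), of size] by simp
    obtain A B where AB: "Ls = A @ L # B" using L(1) by (meson split_list)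
    have "spans r V (E # A @ L' # B)"
      using spD
    proof (rule spans_mset)
      show "mset (concat (E # A @ L' # B)) = mset (concat (D # E # Ls))" by (simp add: AB D L'(2))
      show "closed_walk r M \<and> 3 \<le> length M" if "M \<in> set (E # A @ L' # B)" for M
        using that spD L'(1) len by (auto simp: spans_def AB)
    qed
    then show False using not_spans k AB by fastforce
  qed
  have sets: "set C' = set C" "set P' = set P" using C'(2) P'(2) mset_eq_setD by blast+
  show False
  proof (rule two_ends[OF sp1])
    show "s1 \<in> set C'" "s2 \<in> set C'" "t1 \<in> set P'" "t2 \<in> set P'" by (auto simp: CP)
    show "\<not> r s1 p \<and> \<not> r p s2" if "p \<in> set P'" for p
      using only[of s1 p] only[of s2 p] that dist(1) sets unfolding CP by auto
    show "\<not> r t1 c \<and> \<not> r c t2" if "c \<in> set C'" for c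
      using only[of c t1] only[of c t2] that dist(2) sets unfolding CP by auto
    show "\<not> (r w s2 \<and> r s1 w') \<and> \<not> (r w t2 \<and> r t1 w')" if "L \<in> set Ls" "cyc_gap L w w'" for L w w'
      using no_move[OF sp1 CP(1) that] no_move[OF sp2 CP(2) that] by blast
  qed
qed

end

subsection \<open>Long cycles of a partition\<close>

lemma degree_sum_le_card:
  assumes "finite X" "\<And>v. v \<in> X \<Longrightarrow> \<not> (r u v \<and> r v u')"
  shows "outdeg r X u + indeg r X u' \<le> card X"
proof -
  have "{v \<in> X. r u v} \<inter> {v \<in> X. r v u'} = {}" using assms(2) by auto
  then have "outdeg r X u + indeg r X u' = card ({v \<in> X. r u v} \<union> {v \<in> X. r v u'})"
    unfolding outdeg_def indeg_def using assms(1) by (simp add: card_Un_disjoint)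
  also have "\<dots> \<le> card X" using assms(1) by (intro card_mono) auto
  finally show ?thesis .
qed

lemma sum_outdeg_eq_sum_indeg: "finite X \<Longrightarrow> sum (outdeg r X) X = sum (indeg r X) X"
proof -
  assume "finite X"
  then have "sum (outdeg r X) X = (\<Sum>u\<in>X. \<Sum>v\<in>X. if r u v then 1 else 0)"
    "sum (indeg r X) X = (\<Sum>v\<in>X. \<Sum>u\<in>X. if r u v then 1 else 0)"
    by (simp_all add: outdeg_def indeg_def sum.If_cases Int_def)
  then show ?thesis using sum.swap[of "\<lambda>u v. if r u v then 1 else 0 :: nat" X X] by simp
qed

text \<open>If some \<open>f x\<close> exceeds half of \<open>c\<close>, it is paired with an
  arbitrary other element; the assumption for \<open>x\<close> keeps every remaining value below
  half of \<open>c\<close>.\<close>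

lemma sum_pairwise_le:
  fixes f :: "'a \<Rightarrow> nat"
  assumes "finite L" "2 \<le> card L" "\<And>x y. x \<in> L \<Longrightarrow> y \<in> L \<Longrightarrow> x \<noteq> y \<Longrightarrow> f x + f y \<le> c"
  shows "2 * sum f L \<le> card L * c"
proof (cases "\<exists>x\<in>L. c < 2 * f x")
  case False
  then have "2 * sum f L \<le> (\<Sum>x\<in>L. c)" unfolding sum_distrib_left by (intro sum_mono) (simp add: not_less)
  then show ?thesis by simp
next
  case True
  then obtain x where x: "x \<in> L" "c < 2 * f x" by blast
  have "L \<noteq> {x}" using assms(2) by auto
  then obtain y where y: "y \<in> L" "y \<noteq> x" using x(1) by blast
  have "2 * sum f (L - {x, y}) \<le> (\<Sum>z\<in>L - {x, y}. c)"
    unfolding sum_distrib_left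
  proof (intro sum_mono)
    fix z assume "z \<in> L - {x, y}"
    then have "f x + f z \<le> c" using assms(3)[of x z] x by auto
    then show "2 * f z \<le> c" using x(2) by linarith
  qed
  moreover have "card (L - {x, y}) = card L - 2" using x y assms(1) by (simp add: card_Diff_subset)
  ultimately have "2 * sum f (L - {x, y}) \<le> (card L - 2) * c" by simp
  moreover have "sum f L = f x + (f y + sum f (L - {x, y}))"
    using x y assms(1) sum.remove[of L x f] sum.remove[of "L - {x}" y f] by (simp add: Diff_insert2[symmetric])
  moreover have "f x + f y \<le> c" using assms(3) x y by blast
  moreover have "card L * c = (card L - 2) * c + 2 * c"
    using assms(2) by (metis add_mult_distrib le_add_diff_inverse2)
  ultimately show ?thesis by linarith
qed

lemma sum_concat_le:
  fixes f :: "'a \<Rightarrow> nat"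
  assumes "distinct (concat Ls)" "\<And>L. L \<in> set Ls \<Longrightarrow> 2 * sum f (set L) \<le> length L * c"
  shows "2 * sum f (set (concat Ls)) \<le> length (concat Ls) * c"
  using assms
proof (induction Ls)
  case (Cons L Ls)
  have "sum f (set (concat (L # Ls))) = sum f (set L) + sum f (set (concat Ls))"
    using Cons.prems(1) by (simp add: sum.union_disjoint)
  moreover have "2 * sum f (set L) \<le> length L * c" using Cons.prems(2) by simp
  moreover have "2 * sum f (set (concat Ls)) \<le> length (concat Ls) * c" using Cons by simp
  ultimately show ?case by (simp add: algebra_simps)
qed simp

lemma concat_outdeg_sum:
  assumes "\<And>L. L \<in> set Ls \<Longrightarrow> outdeg r (set L) u + outdeg r (set L) v \<le> length L"
  shows "outdeg r (set (concat Ls)) u + outdeg r (set (concat Ls)) v \<le> length (concat Ls)"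
  using assms
proof (induction Ls)
  case Nil
  then show ?case by (simp add: outdeg_def)
next
  case (Cons L Ls)
  have "outdeg r (set (concat (L # Ls))) x \<le> outdeg r (set L) x + outdeg r (set (concat Ls)) x" for x
    using outdeg_Un[of "set L" "set (concat Ls)"] by auto
  from this[of u] this[of v] show ?case using Cons by fastforce
qed

section \<open>Cutting a cycle at two vertices, and reversal of all arcs\<close>

lemma closed_walk_cut_last:
  assumes "closed_walk r L" "x \<in> set L" "y \<in> set L" "x \<noteq> y"
  obtains A B where "A \<noteq> []" "B \<noteq> []" "last A = x" "last B = y" "mset (A @ B) = mset L" "closed_walk r (A @ B)"
proof -
  obtain D E where L: "L = D @ y # E" using assms(3) by (meson split_list)
  have cl: "closed_walk r (E @ D @ [y])" using closed_walk_rotate[of r "D @ [y]" E] assms(1) by (simp add: L)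
  have "x \<in> set (E @ D)" using assms(2,4) by (auto simp: L)
  then obtain F G where "E @ D = F @ x # G" by (meson split_list)
  then have FG: "E @ D @ [y] = (F @ [x]) @ (G @ [y])" by (metis append.assoc append_Cons append_Nil)
  have "mset ((F @ [x]) @ (G @ [y])) = mset L" unfolding FG[symmetric] by (simp add: L)
  then show ?thesis using that[of "F @ [x]" "G @ [y]"] cl[unfolded FG] by simp
qed

lemma closed_walk_cut_hd:
  assumes "closed_walk r L" "x \<in> set L" "y \<in> set L" "x \<noteq> y"
  obtains A B where "A \<noteq> []" "B \<noteq> []" "hd A = x" "hd B = y" "mset (A @ B) = mset L" "closed_walk r (A @ B)"
proof -
  obtain D where D: "closed_walk r D" "mset D = mset L" "hd D = x" using closed_walk_rotate_to[OF assms(1,2)] .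
  then obtain E where E: "D = x # E" by (cases D) (auto simp: closed_walk_def)
  have "y \<in> set E" using assms(3,4) mset_eq_setD[OF D(2)] by (auto simp: E)
  then obtain F G where "E = F @ y # G" by (meson split_list)
  then show ?thesis using that[of "x # F" "y # G"] D by (simp add: E)
qed

lemma closed_walk_rev: "closed_walk (\<lambda>a b. r b a) xs \<longleftrightarrow> closed_walk r (rev xs)"
  by (auto simp: closed_walk_def hd_rev last_rev)

lemma mset_concat_rev: "mset (concat (map rev Cs)) = mset (concat Cs)"
  by (induction Cs) simp_all

lemma cycle_partition_reverse:
  assumes "cycle_partition (\<lambda>a b. r b a) m K V"
  shows "cycle_partition r m K V"
proof -
  obtain Cs where Cs: "length Cs = K" "\<forall>C\<in>set Cs. closed_walk r (rev C) \<and> m \<le> length C"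
    "distinct (concat Cs)" "set (concat Cs) = V"
    using assms by (auto simp: cycle_partition_def closed_walk_rev[of r])
  show ?thesis
  proof (rule cycle_partitionI[of "map rev Cs" r m "concat Cs"])
    show "mset (concat (map rev Cs)) = mset (concat Cs)" by (rule mset_concat_rev)
    show "closed_walk r C \<and> m \<le> length C" if "C \<in> set (map rev Cs)" for C using that Cs(2) by auto
    show "length (map rev Cs) = K" using Cs(1) by simp
  qed (rule Cs(3,4))+
qed

context stuck
begin

lemma reverse_stuck: "stuck (\<lambda>a b. r b a) V k"
proof
  show "woodall (\<lambda>a b. r b a) V"
    unfolding woodall_def
  proof (intro ballI impI)
    fix u v assume "u \<in> V" "v \<in> V" "u \<noteq> v" "\<not> r v u"
    then have "card V \<le> outdeg r V v + indeg r V u" by (intro woodallD[OF W]) auto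
    then show "card V \<le> outdeg (\<lambda>a b. r b a) V u + indeg (\<lambda>a b. r b a) V v"
      by (simp add: outdeg_def indeg_def)
  qed
  show "\<not> cycle_partition (\<lambda>a b. r b a) 3 k V"
    using cycle_partition_reverse[of r 3 k V] stuck by blast
qed (rule irr)

lemma reverse_spans:
  assumes "spans r V Cs"
  shows "spans (\<lambda>a b. r b a) V (map rev Cs)"
proof -
  have "set (concat (map rev Cs)) = set (concat Cs)" "distinct (concat (map rev Cs)) = distinct (concat Cs)"
    using closed_walk_mset_length[OF mset_concat_rev[of Cs]] by blast+
  then show ?thesis
    using assms unfolding spans_def closed_walk_rev[of r] by (simp only:) simp
qed

lemma one_way_blocks:
  assumes sp: "spans r V Cs" and k: "length Cs = Suc k"
    and CP: "C \<in> set Cs" "P \<in> set Cs" "C \<noteq> P"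
    and mem: "x \<in> set C" "y \<in> set P" "r x y" "x' \<in> set C" "y' \<in> set P"
  shows "\<not> r y' x'"
proof
  assume "r y' x'"
  define Ls where "Ls = remove1 P (remove1 C Cs)"
  have 1: "mset Cs = add_mset C (mset (remove1 C Cs))" using CP(1) by simp
  have "P \<in> set (remove1 C Cs)" using CP by simp
  then have "add_mset P (mset (remove1 C Cs) - {#P#}) = mset (remove1 C Cs)"
    by (intro insert_DiffM) (simp only: set_mset_mset)
  then have 2: "mset (remove1 C Cs) = add_mset P (mset Ls)" by (simp only: Ls_def mset_remove1)
  have "mset (C # P # Ls) = mset Cs" unfolding 1 2 by simp
  then have "spans r V (C # P # Ls)" "length (C # P # Ls) = length Cs"
    using spans_perm[OF sp] mset_eq_length[of "C # P # Ls" Cs] by blast+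
  then show False using one_way[of C P Ls x y x' y'] mem k \<open>r y' x'\<close> by simp
qed

section \<open>One cycle of the partition against the others\<close>

context
  fixes C :: "'a list" and Ls :: "'a list list"
  assumes sp: "spans r V (C # Ls)" and k: "length Ls = k" and pos: "0 < k"
begin

lemma C: "closed_walk r C" "3 \<le> length C" "distinct C" "set C \<subseteq> V"
  using sp by (auto simp: spans_def)

abbreviation "R \<equiv> V - set C"

lemma R: "R = set (concat Ls)" "card V = length C + card R" "finite R"
proof -
  have d: "distinct (C @ concat Ls)" "V = set (C @ concat Ls)" using sp by (auto simp: spans_def)
  then show "R = set (concat Ls)" "finite R" by auto
  then show "card V = length C + card R" using d distinct_card[OF d(1)] distinct_card[of "concat Ls"] by auto
qed

lemma block:
  assumes "L \<in> set Ls"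
  shows "L \<noteq> []" "set L \<subseteq> R" "hd L \<in> set L" "hd L \<in> R" "L \<noteq> C"
proof -
  show 1: "L \<noteq> []" using sp assms by (auto simp: spans_def closed_walk_def)
  show 2: "set L \<subseteq> R" unfolding R(1) using assms by auto
  show 3: "hd L \<in> set L" using 1 by (rule hd_in_set)
  show "hd L \<in> R" using 2 3 by (rule subsetD)
  with 3 show "L \<noteq> C" by auto
qed

lemma degree_split_C: "indeg r V x \<le> indeg r (set C) x + indeg r R x" "outdeg r V x \<le> outdeg r (set C) x + outdeg r R x"
  using indeg_Un[of "set C" R r x] outdeg_Un[of "set C" R r x] R(3) C(4) by (auto simp: Un_absorb1)

lemma one_way_C:
  assumes "x \<in> set C" "L \<in> set Ls" "y \<in> set L" "x' \<in> set C" "y' \<in> set L"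
  shows "\<not> (r x y \<and> r y' x')"
proof
  assume "r x y \<and> r y' x'"
  moreover have "length (C # Ls) = Suc k" "C \<in> set (C # Ls)" "L \<in> set (C # Ls)" "C \<noteq> L"
    using k assms(2) block(5)[OF assms(2)] by auto
  ultimately show False using one_way_blocks[OF sp, of C L x y x' y'] assms by blast
qed

text \<open>Otherwise no arc at all leads from outside into \<open>C\<close>, because arcs between
  two cycles have one direction. A vertex outside and a vertex of \<open>C\<close> then form a
  non-arc whose degrees are confined to \<open>R\<close> and to \<open>C\<close>, together at most
  \<open>card V - 2\<close>.\<close>

lemma unreached_block: "\<exists>L\<in>set Ls. \<forall>x\<in>set C. \<forall>y\<in>set L. \<not> r x y"
proof (rule ccontr)
  assume "\<not> ?thesis"
  then have ex: "\<exists>x\<in>set C. \<exists>y\<in>set L. r x y" if "L \<in> set Ls" for L using that by blast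
  have no: "\<not> r y x" if xy: "x \<in> set C" "y \<in> R" for x y
  proof -
    obtain L where L: "L \<in> set Ls" "y \<in> set L" using xy(2) unfolding R(1) by auto
    obtain x0 y0 where "x0 \<in> set C" "y0 \<in> set L" "r x0 y0" using ex[OF L(1)] by blast
    then show ?thesis using one_way_C[of x0 L y0 x y] L xy(1) by blast
  qed
  obtain L where L: "L \<in> set Ls" using pos k by (cases Ls) auto
  define y where "y = hd L"
  have y: "y \<in> R" unfolding y_def by (rule block(4)[OF L])
  have x: "hd C \<in> set C" using C(1) by (simp add: closed_walk_def)
  let ?x = "hd C"
  have "card V \<le> outdeg r V y + indeg r V ?x" using x y no[OF x y] C(4) by (intro woodallD[OF W]) auto
  moreover have "outdeg r (set C) y = 0" "indeg r R ?x = 0" using no x y by (auto intro!: outdeg_eq_0 indeg_eq_0)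
  moreover have "outdeg r R y < card R" using outdeg_less_card[OF R(3) y] irr by blast
  moreover have "indeg r (set C) ?x < length C" using indeg_less_card[of "set C" ?x r ?x] x irr C(3) by (simp add: distinct_card)
  ultimately show False using degree_split_C(1)[of ?x] degree_split_C(2)[of y] R(2) by linarith
qed

text \<open>A vertex \<open>e\<close> with all its out-neighbours in \<open>C\<close> and a vertex
  of an unreached cycle, whose in-neighbours all lie in \<open>R\<close>, would violate the degree
  condition.\<close>

lemma exit_from_C:
  assumes "e \<in> set C"
  shows "\<exists>y\<in>R. r e y"
proof (rule ccontr)
  assume no: "\<not> ?thesis"
  obtain L where L: "L \<in> set Ls" "\<And>x y. x \<in> set C \<Longrightarrow> y \<in> set L \<Longrightarrow> \<not> r x y" using unreached_block by blast
  define a where "a = hd L"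
  have a: "a \<in> set L" "a \<in> R" unfolding a_def by (rule block(3,4)[OF L(1)])+
  have "card V \<le> outdeg r V e + indeg r V a" using a L(2)[OF assms a(1)] assms C(4) by (intro woodallD[OF W]) auto
  moreover have "outdeg r R e = 0" "indeg r (set C) a = 0" using no L(2) a by (auto intro!: outdeg_eq_0 indeg_eq_0)
  moreover have "indeg r R a < card R" using indeg_less_card[OF R(3) a(2)] irr by blast
  moreover have "outdeg r (set C) e < length C" using outdeg_less_card[of "set C" e r e] assms irr C(3) by (simp add: distinct_card)
  ultimately show False using degree_split_C(1)[of a] degree_split_C(2)[of e] R(2) by linarith
qed

text \<open>A chord cuts off a cycle \<open>Q\<close>; the remaining path \<open>P\<close> is merged with two other cycles.\<close>
lemma no_chord:
  assumes PQ: "mset (P @ Q) = mset C" "P \<noteq> []" "successively r P" "closed_walk r Q" "3 \<le> length Q"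
  shows False
proof -
  let ?s = "hd P" and ?e = "last P"
  have PC: "set P \<subseteq> set C" using mset_eq_setD[OF PQ(1)] by auto
  then have mem: "?s \<in> set C" "?e \<in> set C" using PQ(2) by auto
  obtain y where y: "y \<in> R" "r ?e y" using exit_from_C[OF mem(2)] by blast
  obtain L where L: "L \<in> set Ls" "y \<in> set L" using y(1) unfolding R(1) by auto
  have clL: "closed_walk r L" using sp L(1) by (auto simp: spans_def)
  obtain L' where L': "closed_walk r L'" "mset L' = mset L" "hd L' = y" using closed_walk_rotate_to[OF clL L(2)] .
  \<comment> \<open>\<open>b\<close> is where the walk from \<open>P\<close> ends after entering
    \<open>L\<close> at \<open>y\<close> and running through all of it; the way back from
    \<open>b\<close> to \<open>hd P\<close> has to be found through a third cycle.\<close>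
  define b where "b = last L'"
  obtain X Y where XY: "Ls = X @ L # Y" using L(1) by (meson split_list)
  define Ms where "Ms = X @ Y"
  have L'ne: "L' \<noteq> []" using L'(1) by (simp add: closed_walk_def)
  have bL: "b \<in> set L'" "set L' = set L" "length L' = length L" "distinct L'"
    using L'ne closed_walk_mset_length[OF L'(2)] sp XY by (auto simp: b_def spans_def)
  have noL: "\<not> r v ?s" "\<not> r v x" if "v \<in> set L" "x \<in> set C" for v x
    using one_way_C[OF mem(2) L mem(1) that(1)] one_way_C[OF mem(2) L that(2,1)] y(2) by auto
  have RL: "R = set L \<union> set (concat Ms)" "card R = length L + length (concat Ms)" "distinct (concat Ms)"
  proof -
    have d: "distinct (concat Ls)" using sp by (simp add: spans_def)
    then show "R = set L \<union> set (concat Ms)" "distinct (concat Ms)" unfolding R(1) by (auto simp: XY Ms_def)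
    show "card R = length L + length (concat Ms)" unfolding R(1) distinct_card[OF d] by (simp add: XY Ms_def)
  qed
  \<comment> \<open>No arc leads from \<open>L\<close> to \<open>C\<close>, so in \<open>C\<close>
    and \<open>L\<close> this pair stays at least two below the number of vertices; the surplus
    falls on the cycles in \<open>Ms\<close> and produces a gap there.\<close>
  have "card V \<le> outdeg r V b + indeg r V ?s"
    using noL[of b ?s] mem bL block(2)[OF L(1)] C(4) by (intro woodallD[OF W]) auto
  moreover have "outdeg r (set C) b = 0" "indeg r (set L) ?s = 0" using noL mem bL by (auto intro!: outdeg_eq_0 indeg_eq_0)
  moreover have "outdeg r (set L) b < length L"
    using outdeg_less_card[of "set L" b r b] bL irr by (metis List.finite_set distinct_card)
  moreover have "indeg r (set C) ?s < length C" using indeg_less_card[of "set C" ?s r ?s] mem irr C(3) by (simp add: distinct_card)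
  moreover have "indeg r R ?s \<le> indeg r (set L) ?s + indeg r (set (concat Ms)) ?s"
    "outdeg r R b \<le> outdeg r (set L) b + outdeg r (set (concat Ms)) b"
    unfolding RL(1) by (rule indeg_Un outdeg_Un; simp)+
  ultimately have "length (concat Ms) < indeg r (set (concat Ms)) ?s + outdeg r (set (concat Ms)) b"
    using degree_split_C(1)[of ?s] degree_split_C(2)[of b] R(2) RL(2) by linarith
  then obtain M w w' where M: "M \<in> set Ms" "cyc_gap M w w'" "r w ?s" "r b w'"
    using degree_sum_gap[OF _ RL(3)] by metis
  have clM: "closed_walk r M" using sp M(1) by (auto simp: spans_def XY Ms_def)
  obtain M' where M': "closed_walk r M'" "mset M' = mset M" "hd M' = w'" "last M' = w"
    using closed_walk_rotate_gap[OF clM M(2)] by blast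
  have M'ne: "M' \<noteq> []" using M'(1) by (simp add: closed_walk_def)
  obtain X' Y' where XY': "Ms = X' @ M # Y'" using M(1) by (meson split_list)
  let ?D = "P @ L' @ M'"
  have "closed_walk r ?D"
    using closed_walk_append3[of P L' M' r] PQ(2,3) L' L'ne M' M'ne M(3,4) y(2)
    by (simp add: closed_walk_def b_def)
  moreover have "0 < length P" "0 < length L'" "0 < length M'" using PQ(2) L'ne M'ne by auto
  then have "3 \<le> length ?D" unfolding length_append by linarith
  moreover have "mset (concat (?D # Q # X' @ Y')) = mset (concat (C # Ls))"
  proof -
    have "mset (concat Ls) = mset L + mset M + mset (concat (X' @ Y'))"
    proof -
      have "mset (concat Ls) = mset L + mset (concat Ms)" by (simp add: XY Ms_def)
      then show ?thesis by (simp add: XY')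
    qed
    then show ?thesis using L'(2) M'(2) PQ(1)[symmetric] by simp
  qed
  moreover have "closed_walk r N \<and> 3 \<le> length N" if N: "N \<in> set (X' @ Y')" for N
  proof -
    have "N \<in> set Ms" using N unfolding XY' by auto
    then have "N \<in> set Ls" unfolding XY Ms_def by auto
    then show ?thesis using sp by (simp add: spans_def)
  qed
  ultimately have "spans r V (?D # Q # X' @ Y')"
    using PQ(4,5) by (intro spans_mset[OF sp]) (auto simp del: append_assoc)
  moreover have "length (?D # Q # X' @ Y') = k"
  proof -
    have "length Ls = Suc (length Ms)" by (simp add: XY Ms_def)
    then show ?thesis using k by (simp add: XY')
  qed
  ultimately show False using not_spans by blast
qed

text \<open>An arc between \<open>x\<close> and a vertex other than its two neighbours on the cycle,
  in either direction, cuts off a cycle of length at least 3 and leaves a path, which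
  \<open>no_chord\<close> excludes. The bound is not 1, because the reverse of a cycle arc closes
  only a cycle of length two.\<close>

lemma inner_degree:
  assumes "x \<in> set C"
  shows "outdeg r (set C) x \<le> 2" "indeg r (set C) x \<le> 2"
proof -
  obtain D where D: "closed_walk r D" "mset D = mset C" "hd D = x" using closed_walk_rotate_to[OF C(1) assms] .
  have setD: "set D = set C" "length D = length C" using closed_walk_mset_length[OF D(2)] by auto
  obtain y M z where E: "D = x # y # M @ [z]"
  proof -
    have "\<exists>y M z. D = x # y # M @ [z]"
      using C(2) setD(2) D(3) by (cases D; cases "tl D"; cases "tl (tl D)" rule: rev_cases) auto
    then show ?thesis using that by blast
  qed
  have su: "successively r (x # y # M @ [z])" "r z x" using D(1) by (simp_all add: closed_walk_def E)
  have no: "\<not> r x w" "\<not> r w x" if w: "w \<in> set M" for w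
  proof -
    obtain A B where M: "M = A @ w # B" using w by (meson split_list)
    have s: "successively r ((y # A) @ (w # B @ [z]))" "successively r ((x # y # A @ [w]) @ (B @ [z]))"
      using su(1) by (simp_all add: M successively_Cons)
    show "\<not> r x w"
    proof
      assume "r x w"
      have "successively r (y # A)" "successively r (w # B @ [z])"
        using s(1) unfolding successively_append_iff by blast+
      moreover from this(2) have "closed_walk r ((w # B @ [z]) @ [x])"
        using su(2) \<open>r x w\<close> by (subst closed_walk_append) auto
      moreover have "mset ((y # A) @ ((w # B @ [z]) @ [x])) = mset C" using D(2) by (simp add: E M add_mset_commute)
      ultimately show False
        using no_chord[of "y # A" "(w # B @ [z]) @ [x]"] by simp
    qed
    show "\<not> r w x"
    proof
      assume "r w x"
      have "successively r (x # y # A @ [w])" "successively r (B @ [z])"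
        using s(2) unfolding successively_append_iff by blast+
      moreover have "mset ((B @ [z]) @ (x # y # A @ [w])) = mset C" using D(2) by (simp add: E M add_mset_commute add.commute)
      ultimately show False
        using no_chord[of "B @ [z]" "x # y # A @ [w]"] \<open>r w x\<close> by (simp add: closed_walk_def)
    qed
  qed
  have "v = y \<or> v = z" if "v \<in> set C" "r x v \<or> r v x" for v
    using that no irr unfolding setD(1)[symmetric] E by auto
  then have "{v \<in> set C. r x v} \<subseteq> {y, z}" "{v \<in> set C. r v x} \<subseteq> {y, z}" by blast+
  then have "outdeg r (set C) x \<le> card {y, z}" "indeg r (set C) x \<le> card {y, z}"
    unfolding outdeg_def indeg_def by (simp_all add: card_mono)
  moreover have "card {y, z} \<le> 2" by (simp add: card_insert_if)
  ultimately show "outdeg r (set C) x \<le> 2" "indeg r (set C) x \<le> 2" by linarith+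
qed

end

end

lemma degree_sum_less_card:
  assumes "finite X" "\<And>v. v \<in> X \<Longrightarrow> \<not> (r u v \<and> r v u')" "w \<in> X" "\<not> r u w" "\<not> r w u'"
  shows "outdeg r X u + indeg r X u' < card X"
proof -
  have "{v \<in> X. r u v} = {v \<in> X - {w}. r u v}" "{v \<in> X. r v u'} = {v \<in> X - {w}. r v u'}" using assms(4,5) by auto
  then have "outdeg r X u + indeg r X u' = outdeg r (X - {w}) u + indeg r (X - {w}) u'"
    by (simp add: outdeg_def indeg_def)
  also have "\<dots> \<le> card (X - {w})" using assms(1,2) by (intro degree_sum_le_card) auto
  finally show ?thesis using card_Diff1_less[OF assms(1,3)] by linarith
qed

lemma mset_move_front: "x \<in> set xs \<Longrightarrow> mset (x # remove1 x xs) = mset xs"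
  by simp

lemma distinct_concat_filter: "distinct (concat Ls) \<Longrightarrow> distinct (concat (filter P Ls))"
  by (induction Ls) auto

context stuck
begin

lemma spans_move_front:
  assumes "spans r V Cs" "length Cs = Suc k" "C \<in> set Cs"
  shows "spans r V (C # remove1 C Cs)" "length (remove1 C Cs) = k"
  using spans_perm[OF assms(1) mset_move_front[OF assms(3)]] assms(2,3) by (simp_all add: length_remove1)

text \<open>Any cycle of the partition can be moved to the front, so the bound holds for the short
  cycles too; the count over \<open>B\<close> relies on this.\<close>

lemma block_inner_degree:
  assumes "spans r V Cs" "length Cs = Suc k" "0 < k" "C \<in> set Cs" "x \<in> set C"
  shows "outdeg r (set C) x \<le> 2" "indeg r (set C) x \<le> 2"
  using inner_degree[OF spans_move_front[OF assms(1,2,4)] assms(3,5)] by auto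

section \<open>A cycle with at least four vertices\<close>

context
  fixes C :: "'a list" and Ls :: "'a list list"
  assumes sp: "spans r V (C # Ls)" and k: "length Ls = k" and pos: "0 < k" and four: "4 \<le> length C"
begin

abbreviation "R' \<equiv> V - set C"
definition "A = {v \<in> R'. \<forall>c\<in>set C. r v c}"
definition "B = {v \<in> R'. \<forall>c\<in>set C. r c v}"

lemmas R' = R[OF sp k pos]

text \<open>No \<open>v\<close> outside has both arcs from \<open>x\<close> to \<open>v\<close> and
  from \<open>v\<close> to \<open>y\<close>, because arcs between two cycles have one direction. So
  the degrees outside \<open>C\<close> sum to at most \<open>card R'\<close>, and those inside to at
  most 4. The degree condition leaves no slack: \<open>C\<close> has exactly four vertices and every
  outer vertex is counted once.\<close>

lemma long_cycle_aux:
  assumes "x \<in> set C" "y \<in> set C" "x \<noteq> y" "\<not> r x y"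
  shows "length C = 4" "v \<in> R' \<Longrightarrow> r x v \<or> r v y"
proof -
  have no: "\<not> (r x v \<and> r v y)" if v: "v \<in> R'" for v
  proof -
    obtain L where "L \<in> set Ls" "v \<in> set L" using v unfolding R'(1) by auto
    then show ?thesis using one_way_C[OF sp k pos assms(1) _ _ assms(2)] by blast
  qed
  have "card V \<le> outdeg r V x + indeg r V y" using assms sp by (intro woodallD[OF W]) (auto simp: spans_def)
  moreover have "outdeg r (set C) x \<le> 2" "indeg r (set C) y \<le> 2" using inner_degree[OF sp k pos] assms by auto
  ultimately have le: "length C + card R' \<le> 4 + (outdeg r R' x + indeg r R' y)"
    using degree_split_C(1)[OF sp k pos, of y] degree_split_C(2)[OF sp k pos, of x] R'(2) by linarith
  moreover have "outdeg r R' x + indeg r R' y \<le> card R'" using no R'(3) by (intro degree_sum_le_card) auto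
  ultimately show "length C = 4" using four by linarith
  show "r x v \<or> r v y" if v: "v \<in> R'"
  proof (rule ccontr)
    assume "\<not> ?thesis"
    then have "outdeg r R' x + indeg r R' y < card R'" using no R'(3) v by (intro degree_sum_less_card) auto
    then show False using le four by linarith
  qed
qed

lemma nonadjacent:
  assumes "x \<in> set C"
  shows "\<exists>y\<in>set C. y \<noteq> x \<and> \<not> r x y" "\<exists>y\<in>set C. y \<noteq> x \<and> \<not> r y x"
proof -
  have card: "3 \<le> card (set C - {x})"
    using assms four C(3)[OF sp k pos] by (simp add: distinct_card)
  show "\<exists>y\<in>set C. y \<noteq> x \<and> \<not> r x y"
  proof (rule ccontr)
    assume "\<not> ?thesis"
    then have "set C - {x} \<subseteq> {v \<in> set C. r x v}" by auto
    then have "card (set C - {x}) \<le> outdeg r (set C) x" unfolding outdeg_def by (intro card_mono) auto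
    then show False using inner_degree(1)[OF sp k pos assms] card by linarith
  qed
  show "\<exists>y\<in>set C. y \<noteq> x \<and> \<not> r y x"
  proof (rule ccontr)
    assume "\<not> ?thesis"
    then have "set C - {x} \<subseteq> {v \<in> set C. r v x}" by auto
    then have "card (set C - {x}) \<le> indeg r (set C) x" unfolding indeg_def by (intro card_mono) auto
    then show False using inner_degree(2)[OF sp k pos assms] card by linarith
  qed
qed

lemma hdC: "hd C \<in> set C"
  using C(1)[OF sp k pos] by (simp add: closed_walk_def)

lemma length_4: "length C = 4"
  using nonadjacent(1)[OF hdC] long_cycle_aux(1)[OF hdC] by blast

text \<open>Each \<open>x\<close> of \<open>C\<close> has a non-arc to, and one from, another vertex
  \<open>y\<close> of \<open>C\<close>. For every vertex of \<open>L\<close> the tight case in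
  \<open>long_cycle_aux\<close> then requires one of two arcs, and these have opposite directions
  between \<open>C\<close> and \<open>L\<close>; the direction that does not occur is ruled
  out.\<close>

lemma block_AB:
  assumes L: "L \<in> set Ls"
  shows "set L \<subseteq> A \<or> set L \<subseteq> B"
proof (cases "\<exists>c\<in>set C. \<exists>v\<in>set L. r c v")
  case True
  then obtain c v where cv: "c \<in> set C" "v \<in> set L" "r c v" by blast
  have "r x w" if x: "x \<in> set C" and w: "w \<in> set L" for x w
  proof -
    obtain y where y: "y \<in> set C" "y \<noteq> x" "\<not> r x y" using nonadjacent(1)[OF x] by blast
    have "w \<in> R'" using block(2)[OF sp k pos L] w by blast
    moreover have "\<not> r w y" using one_way_C[OF sp k pos cv(1) L cv(2) y(1) w] cv(3) by blast
    ultimately show ?thesis using long_cycle_aux(2)[OF x y(1)] y by blast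
  qed
  then show ?thesis using block(2)[OF sp k pos L] by (auto simp: B_def)
next
  case False
  have "r w x" if x: "x \<in> set C" and w: "w \<in> set L" for x w
  proof -
    obtain y where y: "y \<in> set C" "y \<noteq> x" "\<not> r y x" using nonadjacent(2)[OF x] by blast
    have "w \<in> R'" using block(2)[OF sp k pos L] w by blast
    then show ?thesis using long_cycle_aux(2)[OF y(1) x y(2,3)] False y(1) w by blast
  qed
  then show ?thesis using block(2)[OF sp k pos L] by (auto simp: A_def)
qed

lemma AB: "R' = A \<union> B" "A \<inter> B = {}" "finite A" "finite B"
proof -
  show "R' = A \<union> B"
  proof
    show "R' \<subseteq> A \<union> B"
    proof
      fix v assume "v \<in> R'"
      then obtain L where "L \<in> set Ls" "v \<in> set L" unfolding R'(1) by auto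
      then show "v \<in> A \<union> B" using block_AB by blast
    qed
  qed (auto simp: A_def B_def)
  show "finite A" "finite B" using R'(3) by (auto simp: A_def B_def)
  have "v \<notin> B" if v: "v \<in> A" for v
  proof
    assume "v \<in> B"
    obtain L where L: "L \<in> set Ls" "v \<in> set L" using v unfolding A_def R'(1) by auto
    show False using one_way_C[OF sp k pos hdC L hdC L(2)] v \<open>v \<in> B\<close> hdC by (auto simp: A_def B_def)
  qed
  then show "A \<inter> B = {}" by blast
qed

text \<open>Two independent arcs from \<open>L\<close> to \<open>M\<close> and a splitting of \<open>C\<close> into two paths turn the three
  cycles \<open>C\<close>, \<open>L\<close>, \<open>M\<close> into two.\<close>
lemma no_two_matching:
  assumes L: "L \<in> set Ls" "set L \<subseteq> B" and M: "M \<in> set Ls" "set M \<subseteq> A"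
    and b: "b1 \<in> set L" "b2 \<in> set L" "b1 \<noteq> b2" and d: "d1 \<in> set M" "d2 \<in> set M" "d1 \<noteq> d2"
    and arcs: "r b1 d1" "r b2 d2"
  shows False
proof -
  define Ms where "Ms = remove1 M (remove1 L Ls)"
  have "L \<noteq> M" using L(2) M(2) b(1) AB(2) by blast
  then have M': "M \<in> set (remove1 L Ls)" using M(1) by simp
  have sp1: "spans r V (C # L # M # Ms)"
  proof (rule spans_perm[OF sp])
    have "mset (C # L # M # Ms) = add_mset C (add_mset L (mset (M # remove1 M (remove1 L Ls))))"
      by (simp only: Ms_def mset.simps)
    also have "\<dots> = add_mset C (mset (L # remove1 L Ls))" unfolding mset_move_front[OF M'] by simp
    also have "\<dots> = mset (C # Ls)" unfolding mset_move_front[OF L(1)] by simp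
    finally show "mset (C # L # M # Ms) = mset (C # Ls)" .
  qed
  have len: "Suc (Suc (length Ms)) = k"
  proof -
    have "length Ls = Suc (length (remove1 L Ls))" "length (remove1 L Ls) = Suc (length Ms)"
      using L(1) M' mset_eq_length[OF mset_move_front[OF L(1)]] mset_eq_length[OF mset_move_front[OF M']]
      by (simp_all add: Ms_def)
    then show ?thesis using k by simp
  qed
  obtain c0 c1 c2 c3 where C4: "C = [c0, c1, c2, c3]"
    using length_4 by (auto simp: length_Suc_conv numeral_eq_Suc)
  have cl: "closed_walk r C" "closed_walk r L" "closed_walk r M" using sp1 by (auto simp: spans_def)
  obtain X1 X2 where X: "X1 \<noteq> []" "X2 \<noteq> []" "last X1 = b1" "last X2 = b2" "mset (X1 @ X2) = mset L" "closed_walk r (X1 @ X2)"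
    using closed_walk_cut_last[OF cl(2) b] .
  obtain Y1 Y2 where Y: "Y1 \<noteq> []" "Y2 \<noteq> []" "hd Y1 = d1" "hd Y2 = d2" "mset (Y1 @ Y2) = mset M" "closed_walk r (Y1 @ Y2)"
    using closed_walk_cut_hd[OF cl(3) d] .
  have X_mem: "hd X1 \<in> B" "hd X2 \<in> B"
    using mset_eq_setD[OF X(5)] X(1,2) L(2) by auto
  have Y_mem: "last Y1 \<in> A" "last Y2 \<in> A"
    using mset_eq_setD[OF Y(5)] Y(1,2) M(2) by auto
  have su: "successively r X1" "successively r X2" "successively r Y1" "successively r Y2" "successively r [c1, c2, c3]"
    using X(6) Y(6) cl(1) by (auto simp: closed_walk_def successively_append_iff C4)
  \<comment> \<open>Vertices of \<open>A\<close> have arcs to all of \<open>C\<close>, and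
    \<open>C\<close> has arcs to all of \<open>B\<close>, so any splitting of \<open>C\<close> into
    two paths closes the two cycles; the arcs from \<open>b1\<close> to \<open>d1\<close> and from
    \<open>b2\<close> to \<open>d2\<close> supply the passage from \<open>L\<close> to
    \<open>M\<close>.\<close>
  let ?D = "X1 @ Y1 @ [c0]" and ?E = "X2 @ Y2 @ [c1, c2, c3]"
  have "c0 \<in> set C" "c1 \<in> set C" "c3 \<in> set C" by (simp_all add: C4)
  then have joins: "r (last Y1) c0" "r c0 (hd X1)" "r (last Y2) c1" "r c3 (hd X2)"
    using X_mem Y_mem by (auto simp: A_def B_def)
  have D: "closed_walk r ?D"
    using closed_walk_append3[of X1 Y1 "[c0]" r] X Y su joins arcs by simp
  have E: "closed_walk r ?E"
    using closed_walk_append3[of X2 Y2 "[c1, c2, c3]" r] X Y su joins arcs by simp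
  have "1 \<le> length X1" "1 \<le> length Y1" using X Y by (simp_all add: Suc_le_eq)
  then have "3 \<le> length X1 + (length Y1 + 1)" by linarith
  then have "3 \<le> length ?D" by simp
  have "spans r V (?D # ?E # Ms)"
    using sp1
  proof (rule spans_mset)
    have "mset (concat (?D # ?E # Ms)) = mset C + mset (X1 @ X2) + mset (Y1 @ Y2) + mset (concat Ms)" by (simp add: C4)
    also have "\<dots> = mset (concat (C # L # M # Ms))" unfolding X(5) Y(5) by simp
    finally show "mset (concat (?D # ?E # Ms)) = mset (concat (C # L # M # Ms))" .
    show "closed_walk r N \<and> 3 \<le> length N" if N: "N \<in> set (?D # ?E # Ms)" for N
    proof -
      consider "N = ?D" | "N = ?E" | "N \<in> set Ms" using N by auto
      then show ?thesis using D E \<open>3 \<le> length ?D\<close> sp1 by cases (auto simp: spans_def)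
    qed
  qed
  then show False using not_spans[of "?D # ?E # Ms"] len by simp
qed

text \<open>The bound holds for each cycle \<open>M\<close> inside \<open>A\<close> separately. If
  one of the two vertices has no arc to \<open>M\<close>, the other contributes at most
  \<open>length M\<close>. If both have arcs, arcs with different heads would be independent, so
  both have the same single out-neighbour in \<open>M\<close> and contribute 2.\<close>

lemma outdeg_A_pair:
  assumes L: "L \<in> set Ls" "set L \<subseteq> B" and b: "b1 \<in> set L" "b2 \<in> set L" "b1 \<noteq> b2"
  shows "outdeg r A b1 + outdeg r A b2 \<le> card A"
proof -
  define Ms where "Ms = filter (\<lambda>L. set L \<subseteq> A) Ls"
  have "A \<subseteq> set (concat Ms)"
  proof
    fix v assume v: "v \<in> A"
    then obtain M where M: "M \<in> set Ls" "v \<in> set M" unfolding A_def R'(1) by auto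
    then have "set M \<subseteq> A" using block_AB[OF M(1)] v AB(2) by blast
    then show "v \<in> set (concat Ms)" using M by (auto simp: Ms_def)
  qed
  then have Ms: "A = set (concat Ms)" by (auto simp: Ms_def)
  have "distinct (concat Ms)" using sp unfolding Ms_def spans_def by (intro distinct_concat_filter) simp
  then have card: "card A = length (concat Ms)" unfolding Ms by (rule distinct_card)
  show ?thesis
    unfolding card unfolding Ms
  proof (rule concat_outdeg_sum)
    fix M assume "M \<in> set Ms"
    then have M: "M \<in> set Ls" "set M \<subseteq> A" by (auto simp: Ms_def)
    have dM: "distinct M" "3 \<le> length M" using sp M(1) by (auto simp: spans_def distinct_concat_iff)
    have le: "outdeg r (set M) b \<le> length M" for b using outdeg_le_card[of "set M" r b] dM(1) by (simp add: distinct_card)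
    show "outdeg r (set M) b1 + outdeg r (set M) b2 \<le> length M"
    proof (cases "(\<exists>d\<in>set M. r b1 d) \<and> (\<exists>d\<in>set M. r b2 d)")
      case False
      then have "outdeg r (set M) b1 = 0 \<or> outdeg r (set M) b2 = 0"
        by (metis outdeg_eq_0)
      then show ?thesis using le[of b1] le[of b2] by linarith
    next
      case True
      then obtain d1 d2 where d: "d1 \<in> set M" "r b1 d1" "d2 \<in> set M" "r b2 d2" by blast
      have same: "e1 = e2" if "e1 \<in> set M" "e2 \<in> set M" "r b1 e1" "r b2 e2" for e1 e2
        using no_two_matching[OF L M b that(1,2) _ that(3,4)] by blast
      have "{v \<in> set M. r b1 v} \<subseteq> {d2}" "{v \<in> set M. r b2 v} \<subseteq> {d1}" using same d by blast+
      then have "outdeg r (set M) b1 \<le> card {d2}" "outdeg r (set M) b2 \<le> card {d1}"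
        unfolding outdeg_def by (simp_all add: card_mono del: card.insert card.empty)
      then show ?thesis using dM(2) by simp
    qed
  qed
qed

text \<open>Double counting of the arcs that leave vertices of \<open>B\<close>: each vertex has at least
  \<open>card B + 2\<close> of them inside \<open>A \<union> B\<close>, but two vertices of the same cycle have together at
  most \<open>card A\<close> arcs into \<open>A\<close>.\<close>
lemma card_B:
  assumes "B \<noteq> {}"
  shows "card B + 3 \<le> card A"
proof -
  define Ms where "Ms = filter (\<lambda>L. set L \<subseteq> B) Ls"
  have "B \<subseteq> set (concat Ms)"
  proof
    fix v assume v: "v \<in> B"
    then obtain M where M: "M \<in> set Ls" "v \<in> set M" unfolding B_def R'(1) by auto
    then have "set M \<subseteq> B" using block_AB[OF M(1)] v AB(2) by blast
    then show "v \<in> set (concat Ms)" using M by (auto simp: Ms_def)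
  qed
  then have Ms: "B = set (concat Ms)" by (auto simp: Ms_def)
  have dist: "distinct (concat Ms)" using sp unfolding Ms_def spans_def by (intro distinct_concat_filter) simp
  then have cardB: "card B = length (concat Ms)" unfolding Ms by (rule distinct_card)
  have cardV: "card V = 4 + card A + card B"
    using R'(2) length_4 AB card_Un_disjoint[of A B] by simp
  have "2 * sum (outdeg r A) B \<le> card B * card A"
    unfolding cardB unfolding Ms
  proof (rule sum_concat_le[OF dist])
    fix L assume "L \<in> set Ms"
    then have L: "L \<in> set Ls" "set L \<subseteq> B" by (auto simp: Ms_def)
    have "distinct L" "3 \<le> length L" using sp L(1) by (auto simp: spans_def distinct_concat_iff)
    then have "card (set L) = length L" "2 \<le> card (set L)" by (simp_all add: distinct_card)
    then show "2 * sum (outdeg r A) (set L) \<le> length L * card A"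
      using sum_pairwise_le[of "set L" "outdeg r A" "card A"] outdeg_A_pair[OF L] by fastforce
  qed
  \<comment> \<open>This is the degree condition for \<open>b\<close> and \<open>hd C\<close>:
    \<open>card V\<close> is \<open>4 + card A + card B\<close>, the in-neighbours of
    \<open>hd C\<close> are at most two in \<open>C\<close> and otherwise lie in \<open>A\<close>,
    and \<open>b\<close> has no arcs to \<open>C\<close>.\<close>
  moreover have "card B + 2 \<le> outdeg r A b + outdeg r B b" if b: "b \<in> B" for b
  proof -
    have no: "\<not> r b c" if c: "c \<in> set C" for c
    proof -
      have "b \<notin> A" using b AB(2) by blast
      obtain L where L: "L \<in> set Ls" "b \<in> set L" using b unfolding B_def R'(1) by auto
      show ?thesis using one_way_C[OF sp k pos c L c L(2)] b c by (auto simp: B_def)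
    qed
    have "card V \<le> outdeg r V b + indeg r V (hd C)"
      using no[OF hdC] b hdC C(4)[OF sp k pos] by (intro woodallD[OF W]) (auto simp: B_def)
    moreover have "indeg r (set C) (hd C) \<le> 2" using inner_degree(2)[OF sp k pos hdC] .
    moreover have "indeg r R' (hd C) \<le> card A"
    proof -
      have "v \<in> A" if v: "v \<in> R'" "r v (hd C)" for v
      proof (rule ccontr)
        assume "v \<notin> A"
        then have vB: "v \<in> B" using v(1) AB(1) by blast
        obtain L where L: "L \<in> set Ls" "v \<in> set L" using v(1) unfolding R'(1) by auto
        show False using one_way_C[OF sp k pos hdC L hdC L(2)] vB v(2) hdC by (auto simp: B_def)
      qed
      then have "{v \<in> R'. r v (hd C)} \<subseteq> A" by blast
      then show ?thesis unfolding indeg_def using AB(3) by (rule card_mono[rotated])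
    qed
    moreover have "outdeg r (set C) b = 0" using no by (auto intro: outdeg_eq_0)
    moreover have "outdeg r R' b \<le> outdeg r A b + outdeg r B b" unfolding AB(1) by (rule outdeg_Un[OF AB(3,4)])
    ultimately show ?thesis
      using degree_split_C(1)[OF sp k pos, of "hd C"] degree_split_C(2)[OF sp k pos, of b] cardV by linarith
  qed
  then have "(\<Sum>b\<in>B. card B + 2) \<le> (\<Sum>b\<in>B. outdeg r A b + outdeg r B b)" by (rule sum_mono)
  then have "card B * (card B + 2) \<le> sum (outdeg r A) B + sum (outdeg r B) B" by (simp add: sum.distrib)
  \<comment> \<open>Vertices of other cycles are joined to \<open>b\<close> in at most one
    direction. In its own cycle \<open>b\<close> has at most 2 + 2 arcs, one more than the minimal
    length 3; this is the 1.\<close>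
  moreover have "outdeg r B b + indeg r B b \<le> card B + 1" if b: "b \<in> B" for b
  proof -
    obtain L where L: "L \<in> set Ls" "b \<in> set L" using b unfolding B_def R'(1) by auto
    have LB: "set L \<subseteq> B" using block_AB[OF L(1)] L(2) b AB(2) by blast
    have dL: "distinct L" "3 \<le> length L" using sp L(1) by (auto simp: spans_def distinct_concat_iff)
    have len: "length (C # Ls) = Suc k" using k by simp
    have "outdeg r (set L) b \<le> 2" "indeg r (set L) b \<le> 2"
      using block_inner_degree[OF sp len pos _ L(2)] L(1) by auto
    moreover have "outdeg r (B - set L) b + indeg r (B - set L) b \<le> card (B - set L)"
    proof (rule degree_sum_le_card)
      fix v assume v: "v \<in> B - set L"
      then obtain M where M: "M \<in> set Ls" "v \<in> set M" unfolding B_def R'(1) by auto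
      then have "M \<noteq> L" using v by blast
      then show "\<not> (r b v \<and> r v b)"
        using one_way_blocks[OF sp len, of L M b v b v] L M by auto
    qed (use AB(4) in auto)
    moreover have "B = set L \<union> (B - set L)" using LB by blast
    then have "outdeg r B b \<le> outdeg r (set L) b + outdeg r (B - set L) b"
      "indeg r B b \<le> indeg r (set L) b + indeg r (B - set L) b"
      using outdeg_Un[of "set L" "B - set L" r b] indeg_Un[of "set L" "B - set L" r b] AB(4) by simp_all
    moreover have "card (B - set L) + length L = card B"
      using card_Diff_subset[OF _ LB] card_mono[OF AB(4) LB] dL(1) by (simp add: distinct_card)
    ultimately show ?thesis using dL(2) by linarith
  qed
  then have "(\<Sum>b\<in>B. outdeg r B b + indeg r B b) \<le> (\<Sum>b\<in>B. card B + 1)" by (rule sum_mono)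
  then have "2 * sum (outdeg r B) B \<le> card B * (card B + 1)"
    using sum_outdeg_eq_sum_indeg[OF AB(4), of r] by (simp add: sum.distrib)
  ultimately have "2 * (card B * (card B + 2)) \<le> card B * card A + card B * (card B + 1)" by linarith
  then have "card B * (2 * card B + 4) \<le> card B * (card A + card B + 1)" by (simp add: algebra_simps)
  moreover have "0 < card B" using assms AB(4) by (simp add: card_gt_0_iff)
  ultimately have "2 * card B + 4 \<le> card A + card B + 1" by (rule mult_left_le_imp_le)
  then show ?thesis by linarith
qed

end

lemma no_spans:
  assumes sp: "spans r V Cs" and len: "length Cs = Suc k" and pos: "0 < k" and big: "3 * Suc k < card V"
  shows False
proof -
  have "\<exists>C\<in>set Cs. 4 \<le> length C"
  proof (rule ccontr)
    assume "\<not> ?thesis"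
    then have "\<forall>C\<in>set Cs. length C \<le> 3" by fastforce
    then have "length (concat Cs) \<le> 3 * length Cs" by (induction Cs) auto
    moreover have "length (concat Cs) = card V" using sp distinct_card by (metis spans_def)
    ultimately show False using big len by simp
  qed
  then obtain C where C: "C \<in> set Cs" "4 \<le> length C" by blast
  let ?Ls = "remove1 C Cs"
  note sp' = spans_move_front[OF sp len C(1)] 
  have sp1: "spans r V (C # ?Ls)" and k1: "length ?Ls = k" using sp' by auto
  interpret D: stuck "\<lambda>a b. r b a" V k by (rule reverse_stuck)
  have sp2: "spans (\<lambda>a b. r b a) V (rev C # map rev ?Ls)" using reverse_spans[OF sp1] by simp
  have k2: "length (map rev ?Ls) = k" "4 \<le> length (rev C)" using k1 C(2) by simp_all
  have swap: "D.A (rev C) = B C" "D.B (rev C) = A C"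
    by (simp_all add: A_def[OF sp1 k1 pos C(2)] B_def[OF sp1 k1 pos C(2)]
      D.A_def[OF sp2 k2(1) pos k2(2)] D.B_def[OF sp2 k2(1) pos k2(2)])
  note AB1 = AB[OF sp1 k1 pos C(2)]
  obtain L where "L \<in> set ?Ls" using k1 pos by (cases ?Ls) auto
  \<comment> \<open>As \<open>k\<close> is positive, one of the two sets is nonempty.
    \<open>card_B\<close>, for the digraph or its reverse, makes the other one larger by 3, hence
    nonempty too, and then the opposite inequality holds as well.\<close>
  then have "A C \<union> B C \<noteq> {}" using block(4)[OF sp1 k1 pos] AB1(1) by blast
  then show False
    using card_B[OF sp1 k1 pos C(2)] D.card_B[OF sp2 k2(1) pos k2(2)] swap AB1(3,4) by fastforce
qed

end

lemma packing_cycle_partition_pred: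
  assumes "finite V" "woodall r V" "\<And>x. \<not> r x x" "packing r 3 V Cs" "length Cs = Suc k" "0 < k" "3 * Suc k < card V"
  shows "cycle_partition r 3 k V"
proof (rule ccontr)
  assume stuck: "\<not> ?thesis"
  then interpret stuck r V k using assms(2,3) by unfold_locales auto
  have "cycle_partition r 3 (Suc k) V"
    using packing_cycle_partition[of V r 3 Cs] assms(1-5) stuck by fastforce
  then obtain Ds where "spans r V Ds" "length Ds = Suc k" by (auto simp: cycle_partition_def spans_def)
  then show False using no_spans assms(6,7) by blast
qed

subsection \<open>Contracting a perfect matching\<close>

lemma closed_walk_conv_nth:
  "xs \<noteq> [] \<Longrightarrow> closed_walk r xs \<longleftrightarrow> (\<forall>i<length xs. r (xs ! i) (xs ! ((i + 1) mod length xs)))"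
proof (intro iffI allI impI)
  fix i assume ne: "xs \<noteq> []" and cl: "closed_walk r xs" and i: "i < length xs"
  show "r (xs ! i) (xs ! ((i + 1) mod length xs))"
  proof (cases "Suc i < length xs")
    case True
    then show ?thesis using cl by (auto simp: closed_walk_def successively_conv_nth)
  next
    case False
    then have "Suc i = length xs" "i = length xs - 1" using i by auto
    then show ?thesis using cl ne by (simp add: closed_walk_def last_conv_nth hd_conv_nth)
  qed
next
  assume ne: "xs \<noteq> []" and all: "\<forall>i<length xs. r (xs ! i) (xs ! ((i + 1) mod length xs))"
  have "successively r xs"
    unfolding successively_conv_nth
  proof (intro allI impI)
    fix i assume "Suc i < length xs"
    then show "r (xs ! i) (xs ! Suc i)" using all[rule_format, of i] by simp
  qed
  moreover have "r (last xs) (hd xs)"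
    using all[rule_format, of "length xs - 1"] ne by (simp add: last_conv_nth hd_conv_nth)
  ultimately show "closed_walk r xs" using ne by (simp add: closed_walk_def)
qed

lemma is_cycle_iff: "is_cycle E vs \<longleftrightarrow> 3 \<le> length vs \<and> distinct vs \<and> closed_walk (\<lambda>u v. {u, v} \<in> E) vs"
proof (cases "vs = []")
  case False
  then show ?thesis unfolding is_cycle_def closed_walk_conv_nth[OF False] by simp
qed (simp add: is_cycle_def)

text \<open>Taking \<open>cyc_gap xs\<close> itself as the relation turns the indices modulo the
  length, which occur in \<open>cycle_edges\<close>, into gaps.\<close>

lemma closed_walk_cyc_gap:
  assumes "xs \<noteq> []"
  shows "closed_walk (cyc_gap xs) xs"
proof -
  have "gap xs (xs ! i) (xs ! Suc i)" if "Suc i < length xs" for i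
  proof -
    have "xs = take i xs @ xs ! i # xs ! Suc i # drop (Suc (Suc i)) xs"
      using that by (simp add: Cons_nth_drop_Suc Suc_lessD)
    then show ?thesis unfolding gap_def by blast
  qed
  then show ?thesis using assms by (simp add: closed_walk_def cyc_gap_def successively_conv_nth)
qed

lemma cycle_edgeE:
  assumes "{u, v} \<in> cycle_edges vs"
  shows "cyc_gap vs u v \<or> cyc_gap vs v u"
proof -
  obtain i where i: "i < length vs" "{u, v} = {vs ! i, vs ! ((i + 1) mod length vs)}"
    using assms by (auto simp: cycle_edges_def)
  then have "vs \<noteq> []" by auto
  then have "cyc_gap vs (vs ! i) (vs ! ((i + 1) mod length vs))"
    using closed_walk_cyc_gap[of vs] i(1) by (simp add: closed_walk_conv_nth)
  then show ?thesis using i(2) by (auto simp: doubleton_eq_iff)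
qed

lemma cycle_edge_subset:
  assumes "e \<in> cycle_edges vs"
  shows "e \<subseteq> set vs" "e \<noteq> {}"
proof -
  obtain i where i: "i < length vs" "e = {vs ! i, vs ! ((i + 1) mod length vs)}"
    using assms by (auto simp: cycle_edges_def)
  have "(i + 1) mod length vs < length vs" by (rule mod_less_divisor) (use i in auto)
  then show "e \<subseteq> set vs" "e \<noteq> {}" using i nth_mem by auto
qed

lemma gap_cycle_edge:
  assumes "gap vs u v"
  shows "{u, v} \<in> cycle_edges vs"
proof -
  obtain A B where "vs = A @ u # v # B" using assms by (auto simp: gap_def)
  then have "vs ! length A = u" "vs ! ((length A + 1) mod length vs) = v" "length A < length vs"
    by (auto simp: nth_append)
  then show ?thesis unfolding cycle_edges_def by blast
qed

lemma gap_Nil [simp]: "\<not> gap [] u v"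
  by (simp add: gap_def)

lemma gap_append_iff:
  "gap (xs @ ys) u v \<longleftrightarrow> gap xs u v \<or> gap ys u v \<or> xs \<noteq> [] \<and> ys \<noteq> [] \<and> u = last xs \<and> v = hd ys"
proof (induction xs)
  case Nil
  then show ?case by simp
next
  case (Cons x xs)
  then show ?case by (cases "xs = []") (auto simp: gap_Cons_iff)
qed

lemma cyc_gap_rotate: "cyc_gap (xs @ ys) u v \<longleftrightarrow> cyc_gap (ys @ xs) u v"
  by (cases "xs = []"; cases "ys = []") (auto simp: cyc_gap_def gap_append_iff)

lemma gap_rev: "gap (rev xs) u v \<longleftrightarrow> gap xs v u"
proof -
  have "gap (rev xs) u v" if "gap xs v u" for xs :: "'a list" and u v
    using that unfolding gap_def by fastforce
  from this[of xs v u] this[of "rev xs" u v] show ?thesis by auto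
qed

lemma cyc_gap_rev: "cyc_gap (rev xs) u v \<longleftrightarrow> cyc_gap xs v u"
  by (auto simp: cyc_gap_def gap_rev hd_rev last_rev)

lemma cyc_gap_normal_form:
  assumes "cyc_gap vs u v" "u \<noteq> v"
  obtains B A where "vs = A @ B" "\<exists>ws. B @ A = u # v # ws"
proof (cases "gap vs u v")
  case True
  then obtain A B where "vs = A @ u # v # B" by (auto simp: gap_def)
  then show thesis using that[of A "u # v # B"] by simp
next
  case False
  then have ne: "vs \<noteq> []" "u = last vs" "v = hd vs" using assms(1) by (auto simp: cyc_gap_def)
  then have "vs = butlast vs @ [u]" by simp
  moreover have "butlast vs \<noteq> []" using ne assms(2) by (cases vs) auto
  then have "butlast vs = v # tl (butlast vs)" using ne by (cases vs) auto
  ultimately show thesis using that[of "butlast vs" "[u]"] by auto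
qed

lemma vertex_disjoint_Cons:
  "vertex_disjoint (c # cs) \<longleftrightarrow> (\<forall>d\<in>set cs. set c \<inter> set d = {}) \<and> vertex_disjoint cs"
  unfolding vertex_disjoint_def length_Cons All_less_Suc2
  by (auto simp: all_set_conv_all_nth; blast)

lemma distinct_concat_iff_vertex_disjoint:
  "distinct (concat cs) \<longleftrightarrow> (\<forall>c\<in>set cs. distinct c) \<and> vertex_disjoint cs"
proof (induction cs)
  case Nil
  then show ?case by (simp add: vertex_disjoint_def)
next
  case (Cons c cs)
  then show ?case by (auto simp: vertex_disjoint_Cons)
qed

section \<open>The digraph of a bipartite graph with a perfect matching\<close>

locale matched_bipartite =
  fixes X Y :: "'a set" and E M :: "'a set set"
  assumes bipartite: "bipartite_graph X Y E" and matching: "perfect_matching (X \<union> Y) E M"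
begin

definition partner :: "'a \<Rightarrow> 'a" where
  "partner v = (THE w. {v, w} \<in> M)"

text \<open>The condition \<open>x \<noteq> x'\<close> removes the loop that the matching edge at
  \<open>x\<close> would give; the degree lemmas pay for it with 1.\<close>

definition arc :: "'a \<Rightarrow> 'a \<Rightarrow> bool" where
  "arc x x' \<longleftrightarrow> x \<in> X \<and> x' \<in> X \<and> x \<noteq> x' \<and> {x, partner x'} \<in> E"

lemma finite_parts: "finite X" "finite Y"
  using bipartite by (auto simp: bipartite_graph_def)

lemma not_in_Y: "v \<in> X \<Longrightarrow> v \<notin> Y"
  using bipartite by (auto simp: bipartite_graph_def)

lemma edgeE: "e \<in> E \<Longrightarrow> \<exists>x\<in>X. \<exists>y\<in>Y. e = {x, y}"
proof -
  assume "e \<in> E"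
  then have "e \<in> {{x, y} | x y. x \<in> X \<and> y \<in> Y}" using bipartite unfolding bipartite_graph_def by blast
  then show ?thesis by blast
qed

lemma edge_ends: "{u, v} \<in> E \<Longrightarrow> u \<in> X \<and> v \<in> Y \<or> u \<in> Y \<and> v \<in> X"
  using edgeE[of "{u, v}"] by (auto simp: doubleton_eq_iff)

lemma edge_X: "{u, v} \<in> E \<Longrightarrow> u \<in> X \<Longrightarrow> v \<in> Y"
  and edge_Y: "{u, v} \<in> E \<Longrightarrow> u \<in> Y \<Longrightarrow> v \<in> X"
  using edge_ends[of u v] not_in_Y by auto

lemma M_E: "e \<in> M \<Longrightarrow> e \<in> E"
  using matching by (auto simp: perfect_matching_def)

lemma M_unique: "v \<in> X \<union> Y \<Longrightarrow> e \<in> M \<Longrightarrow> e' \<in> M \<Longrightarrow> v \<in> e \<Longrightarrow> v \<in> e' \<Longrightarrow> e = e'"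
  using matching unfolding perfect_matching_def by blast

lemma partner_eq: "{v, w} \<in> M \<Longrightarrow> partner v = w"
proof -
  assume vw: "{v, w} \<in> M"
  show ?thesis
    unfolding partner_def
  proof (rule the_equality)
    show "{v, w} \<in> M" by (rule vw)
    fix w' assume "{v, w'} \<in> M"
    moreover have "v \<in> X \<union> Y" using edge_ends[OF M_E[OF vw]] by auto
    ultimately show "w' = w" using M_unique[of v "{v, w'}" "{v, w}"] vw by (auto simp: doubleton_eq_iff)
  qed
qed

lemma partner: "v \<in> X \<union> Y \<Longrightarrow> {v, partner v} \<in> M"
proof -
  assume "v \<in> X \<union> Y"
  then obtain e where e: "e \<in> M" "v \<in> e" using matching unfolding perfect_matching_def by blast
  obtain x y where "e = {x, y}" using edgeE[OF M_E[OF e(1)]] by blast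
  then have "e = {v, x} \<or> e = {v, y}" using e(2) by auto
  then obtain w where "{v, w} \<in> M" using e(1) by auto
  then show ?thesis using partner_eq by simp
qed

lemma partner_edge: "v \<in> X \<union> Y \<Longrightarrow> {v, partner v} \<in> E"
  using M_E partner by blast

lemma partner_X: "x \<in> X \<Longrightarrow> partner x \<in> Y"
  and partner_Y: "y \<in> Y \<Longrightarrow> partner y \<in> X"
  using partner_edge edge_X edge_Y by blast+

lemma partner_partner: "v \<in> X \<union> Y \<Longrightarrow> partner (partner v) = v"
  using partner partner_eq[of "partner v" v] by (simp add: insert_commute)

text \<open>The neighbours of \<open>x\<close> are the partners of \<open>x\<close> and of its
  out-neighbours; the 1 is the matching edge at \<open>x\<close>, which yields no arc.\<close>

lemma degree_X:
  assumes "x \<in> X"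
  shows "degree E x \<le> outdeg arc X x + 1"
proof -
  let ?N = "{x' \<in> X. arc x x'}"
  have "{u. {u, x} \<in> E} \<subseteq> partner ` insert x ?N"
  proof
    fix u assume "u \<in> {u. {u, x} \<in> E}"
    then have e: "{x, u} \<in> E" by (simp add: insert_commute)
    then have u: "u \<in> Y" "partner u \<in> X" "partner (partner u) = u"
      using edge_X[OF e assms] partner_Y partner_partner by auto
    then have "partner u \<in> insert x ?N" using e assms by (auto simp: arc_def)
    then show "u \<in> partner ` insert x ?N" using u(3) by (metis imageI)
  qed
  then have "degree E x \<le> card (partner ` insert x ?N)"
    unfolding degree_def using finite_parts(1) by (intro card_mono) auto
  also have "\<dots> \<le> card (insert x ?N)" using finite_parts(1) by (intro card_image_le) auto
  also have "\<dots> \<le> outdeg arc X x + 1" using finite_parts(1) by (simp add: outdeg_def card_insert_if)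
  finally show ?thesis .
qed

lemma degree_Y:
  assumes "x \<in> X"
  shows "degree E (partner x) \<le> indeg arc X x + 1"
proof -
  let ?N = "{x' \<in> X. arc x' x}"
  have "{u. {u, partner x} \<in> E} \<subseteq> insert x ?N"
  proof
    fix u assume "u \<in> {u. {u, partner x} \<in> E}"
    then have e: "{u, partner x} \<in> E" by simp
    then have "u \<in> X" using edge_ends[OF e] not_in_Y partner_X[OF assms] by auto
    then show "u \<in> insert x ?N" using e assms by (auto simp: arc_def)
  qed
  then have "degree E (partner x) \<le> card (insert x ?N)"
    unfolding degree_def using finite_parts(1) by (intro card_mono) auto
  also have "\<dots> \<le> indeg arc X x + 1" using finite_parts(1) by (simp add: indeg_def card_insert_if)
  finally show ?thesis .
qed

lemma woodall_arc:
  assumes "enat (card X + 2) \<le> sigma11 X Y E"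
  shows "woodall arc X"
  unfolding woodall_def
proof (intro ballI impI)
  fix u v assume u: "u \<in> X" and v: "v \<in> X" and "u \<noteq> v" "\<not> arc u v"
  then have no: "{u, partner v} \<notin> E" by (simp add: arc_def)
  define D where "D = {degree E x + degree E y | x y. x \<in> X \<and> y \<in> Y \<and> {x, y} \<notin> E}"
  have "D \<subseteq> (\<lambda>(x, y). degree E x + degree E y) ` (X \<times> Y)" by (auto simp: D_def)
  then have "finite D" by (rule finite_subset) (simp add: finite_parts)
  moreover have "degree E u + degree E (partner v) \<in> D"
    unfolding D_def using u no partner_X[OF v] by blast
  ultimately have "Min D \<le> degree E u + degree E (partner v)" by (rule Min_le)
  moreover have "\<not> (\<forall>x\<in>X. \<forall>y\<in>Y. {x, y} \<in> E)" using u partner_X[OF v] no by blast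
  then have "sigma11 X Y E = enat (Min D)" unfolding sigma11_def D_def by (rule if_not_P)
  then have "card X + 2 \<le> Min D" using assms by simp
  ultimately show "card X \<le> outdeg arc X u + indeg arc X v"
    using degree_X[OF u] degree_Y[OF v] by linarith
qed

section \<open>Weaving directed cycles into M-cycles and back\<close>

abbreviation "weave xs \<equiv> concat (map (\<lambda>x. [x, partner x]) xs)"

lemma set_weave: "set (weave xs) = set xs \<union> partner ` set xs"
  by auto

lemma weave_eq_Nil: "weave xs = [] \<longleftrightarrow> xs = []"
  by (cases xs) auto

lemma length_weave: "length (weave xs) = 2 * length xs"
  by (induction xs) auto

lemma distinct_weave: "set xs \<subseteq> X \<Longrightarrow> distinct xs \<Longrightarrow> distinct (weave xs)"
proof (induction xs)
  case (Cons x xs)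
  have x: "x \<in> X" "set xs \<subseteq> X" "x \<notin> set xs" using Cons.prems by auto
  have "partner x \<notin> partner ` set xs"
  proof
    assume "partner x \<in> partner ` set xs"
    then obtain v where v: "v \<in> set xs" "partner x = partner v" by blast
    then have "partner (partner x) = v" using partner_partner[of v] x(2) by auto
    then show False using partner_partner[of x] x v(1) by simp
  qed
  moreover have "x \<notin> partner ` set xs" "partner x \<noteq> x" "partner x \<notin> set xs"
    using x(1,2) partner_X[OF x(1)] partner_X not_in_Y[of x] not_in_Y[of "partner x"] by auto
  ultimately show ?case using Cons.IH[OF x(2)] Cons.prems(2) x(3) by (simp add: set_weave del: set_concat)
qed simp

lemma distinct_of_weave: "distinct (weave xs) \<Longrightarrow> distinct xs"
  by (induction xs) auto

lemma last_weave: "xs \<noteq> [] \<Longrightarrow> last (weave xs) = partner (last xs)"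
  by (induction xs rule: rev_induct) auto

lemma hd_weave: "xs \<noteq> [] \<Longrightarrow> hd (weave xs) = hd xs"
  by (cases xs) auto

lemma successively_weave:
  assumes "set xs \<subseteq> X"
  shows "successively (\<lambda>u v. {u, v} \<in> E) (weave xs) \<longleftrightarrow> successively (\<lambda>x x'. {x', partner x} \<in> E) xs"
  using assms
proof (induction xs)
  case (Cons x xs)
  then show ?case
    using partner_edge[of x] by (cases xs) (auto simp: insert_commute)
qed simp

lemma closed_walk_weave:
  assumes "set xs \<subseteq> X"
  shows "closed_walk (\<lambda>u v. {u, v} \<in> E) (weave xs) \<longleftrightarrow> closed_walk (\<lambda>x x'. {x', partner x} \<in> E) xs"
  unfolding closed_walk_def weave_eq_Nil successively_weave[OF assms]
  by (cases "xs = []") (auto simp: last_weave hd_weave insert_commute)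

text \<open>A woven list passes from \<open>partner x\<close> to the next vertex \<open>x'\<close>,
  and this edge is the arc from \<open>x'\<close> to \<open>x\<close>. Weaving therefore reads the
  arcs backwards, whence \<open>rev\<close>. Distinctness and length at least 2 ensure that
  consecutive vertices differ, as \<open>arc\<close> demands.\<close>

lemma closed_walk_arc:
  assumes "set xs \<subseteq> X" "distinct xs" "2 \<le> length xs"
  shows "closed_walk arc (rev xs) \<longleftrightarrow> closed_walk (\<lambda>x x'. {x', partner x} \<in> E) xs"
proof -
  have "xs \<noteq> []" using assms(3) by auto
  have "closed_walk arc (rev xs) \<longleftrightarrow> closed_walk (\<lambda>x x'. arc x' x) xs" by (rule closed_walk_rev[symmetric])
  also have "\<dots> \<longleftrightarrow> closed_walk (\<lambda>x x'. {x', partner x} \<in> E) xs"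
    unfolding closed_walk_conv_nth[OF \<open>xs \<noteq> []\<close>]
  proof (intro all_cong)
    fix i assume i: "i < length xs"
    have j: "(i + 1) mod length xs < length xs" by (rule mod_less_divisor) (use i in auto)
    have "(i + 1) mod length xs \<noteq> i"
    proof (cases "i + 1 = length xs")
      case True
      then show ?thesis using assms(3) by auto
    qed (use i in auto)
    then have "xs ! ((i + 1) mod length xs) \<noteq> xs ! i"
      using nth_eq_iff_index_eq[OF assms(2) j i] by simp
    then show "arc (xs ! ((i + 1) mod length xs)) (xs ! i) \<longleftrightarrow> {xs ! ((i + 1) mod length xs), partner (xs ! i)} \<in> E"
      using i j assms(1) by (auto simp: arc_def subset_iff)
  qed
  finally show ?thesis .
qed

text \<open>The first vertex has only the second one next to it, so these two are partners. The
  third vertex is adjacent to a vertex of \<open>Y\<close>, hence lies in \<open>X\<close> again,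
  and the pair can be split off.\<close>

lemma unweave:
  assumes "distinct zs" "set zs \<subseteq> X \<union> Y" "successively (\<lambda>u v. {u, v} \<in> E) zs" "zs = [] \<or> hd zs \<in> X"
    and "\<And>v. v \<in> set zs \<Longrightarrow> gap zs v (partner v) \<or> gap zs (partner v) v"
  shows "\<exists>xs. set xs \<subseteq> X \<and> zs = weave xs"
  using assms
proof (induction zs rule: induct_list012)
  case 1
  then show ?case by (intro exI[of _ "[]"]) simp
next
  case (2 a)
  then show ?case by (auto simp: gap_Cons_iff gap_def)
next
  case (3 a b zs)
  have dist: "a \<noteq> b" "a \<notin> set zs" "b \<notin> set zs" using 3(3) by auto
  have "gap (a # b # zs) a (partner a) \<or> gap (a # b # zs) (partner a) a" by (rule 3(7)) simp
  then have b: "partner a = b"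
    using dist gap_mem[of zs a "partner a"] gap_mem[of zs "partner a" a]
    by (cases zs) (auto simp: gap_Cons_iff)
  have a: "a \<in> X" using 3(6) by simp
  then have pb: "partner b = a" "b \<in> Y" using partner_partner[of a] partner_X[of a] b by auto
  have "gap zs v (partner v) \<or> gap zs (partner v) v" if v: "v \<in> set zs" for v
  proof -
    have "v \<in> X \<union> Y" using v 3(4) by auto
    then have "partner (partner v) = v" by (rule partner_partner)
    moreover have va: "v \<noteq> a" "v \<noteq> b" using v dist by auto
    ultimately have "partner v \<noteq> a" "partner v \<noteq> b" using b pb(1) by metis+
    moreover note va
    moreover have "gap (a # b # zs) v (partner v) \<or> gap (a # b # zs) (partner v) v" by (rule 3(7)) (simp add: v)
    ultimately show ?thesis by (simp add: gap_Cons_iff)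
  qed
  moreover have "zs = [] \<or> hd zs \<in> X"
    using 3(5) pb(2) edge_Y[of b "hd zs"] by (cases zs) auto
  moreover have "successively (\<lambda>u v. {u, v} \<in> E) zs" using 3(5) by (cases zs) auto
  ultimately obtain xs where "set xs \<subseteq> X" "zs = weave xs" using 3(1) 3(3,4) by auto
  then show ?case using a b by (intro exI[of _ "a # xs"]) auto
qed

text \<open>The matching edges on the cycle are pairwise disjoint, have two elements each and number
  half the length of the cycle, so together they cover all its vertices.\<close>

lemma M_cycle_partner_edge:
  assumes "M_cycle E M vs" "v \<in> set vs"
  shows "{v, partner v} \<in> cycle_edges vs" "v \<in> X \<union> Y" "partner v \<in> set vs"
proof -
  let ?S = "cycle_edges vs \<inter> M"
  have d: "distinct vs" and ne: "vs \<noteq> []" using assms by (auto simp: M_cycle_def is_cycle_def)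
  note ends = cycle_edge_subset(1)[of _ vs]
  have two: "card e = 2" if eM: "e \<in> M" for e
  proof -
    obtain x y where "x \<in> X" "y \<in> Y" "e = {x, y}" using edgeE[OF M_E[OF eM]] by blast
    then show ?thesis using not_in_Y by (metis card_2_iff)
  qed
  have "pairwise disjnt ?S"
  proof (rule pairwiseI)
    fix e e' assume e: "e \<in> ?S" "e' \<in> ?S" "e \<noteq> e'"
    have "v \<in> X \<union> Y" if "v \<in> e" for v using that e(1) edgeE[OF M_E] by blast
    then show "disjnt e e'" using e M_unique unfolding disjnt_def by blast
  qed
  then have "card (\<Union>?S) = sum card ?S" by (rule card_Union_disjoint) (use two in \<open>auto intro: card_ge_0_finite\<close>)
  also have "\<dots> = length vs" using two assms(1) by (simp add: M_cycle_def)
  also have "\<dots> = card (set vs)" using d by (simp add: distinct_card)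
  finally have "\<Union>?S = set vs" using ends by (intro card_subset_eq) auto
  then obtain e where e: "e \<in> ?S" "v \<in> e" using assms(2) by blast
  then show vXY: "v \<in> X \<union> Y" using edgeE[OF M_E] by blast
  then have "e = {v, partner v}" using M_unique[of v e "{v, partner v}"] partner[of v] e by blast
  then show "{v, partner v} \<in> cycle_edges vs" "partner v \<in> set vs" using e ends by auto
qed

lemma M_cycle_imp_closed_walk:
  assumes "M_cycle E M vs" "6 \<le> length vs"
  shows "\<exists>xs. closed_walk arc xs \<and> 3 \<le> length xs \<and> distinct xs \<and> set xs \<subseteq> set vs \<inter> X"
proof -
  have cyc: "distinct vs" "closed_walk (\<lambda>u v. {u, v} \<in> E) vs" "vs \<noteq> []"
    using assms by (auto simp: M_cycle_def is_cycle_iff)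
  obtain x where x: "x \<in> set vs" "x \<in> X"
  proof -
    have "hd vs \<in> set vs" using cyc(3) by simp
    then have "hd vs \<in> X \<union> Y" "partner (hd vs) \<in> set vs" "hd vs \<in> set vs"
      using M_cycle_partner_edge(2,3)[OF assms(1)] by blast+
    then show thesis using that partner_Y by blast
  qed
  \<comment> \<open>The cycle is traversed in the direction in which the partner of \<open>x\<close>
    follows \<open>x\<close>; after a rotation it starts with this pair.\<close>
  define ws where "ws = (if cyc_gap vs x (partner x) then vs else rev vs)"
  have ws: "cyc_gap ws x (partner x)" "distinct ws" "set ws = set vs" "length ws = length vs"
    using cycle_edgeE[OF M_cycle_partner_edge(1)[OF assms(1) x(1)]] cyc(1) by (auto simp: ws_def cyc_gap_rev)
  have cl_ws: "closed_walk (\<lambda>u v. {u, v} \<in> E) ws"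
    using cyc(2) closed_walk_rev[of "\<lambda>u v. {u, v} \<in> E" vs] by (auto simp: ws_def insert_commute)
  have adj_ws: "cyc_gap ws v (partner v) \<or> cyc_gap ws (partner v) v" if "v \<in> set vs" for v
    using cycle_edgeE[OF M_cycle_partner_edge(1)[OF assms(1) that]] by (auto simp: ws_def cyc_gap_rev)
  have "x \<noteq> partner x" using x(2) partner_X not_in_Y by metis
  then obtain A B where AB: "ws = A @ B" "\<exists>us. B @ A = x # partner x # us"
    using cyc_gap_normal_form[OF ws(1)] by blast
  then obtain us where us: "B @ A = x # partner x # us" by blast
  let ?zs = "x # partner x # us"
  have zs: "distinct ?zs" "set ?zs = set vs" "length ?zs = length vs"
    using ws(2-4) unfolding us[symmetric] AB(1) by auto
  have cl: "closed_walk (\<lambda>u v. {u, v} \<in> E) ?zs"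
    using cl_ws closed_walk_rotate[of _ A B] unfolding us[symmetric] AB(1) by simp
  have "\<exists>xs. set xs \<subseteq> X \<and> ?zs = weave xs"
  proof (rule unweave[OF zs(1)])
    show "set ?zs \<subseteq> X \<union> Y" unfolding zs(2) using M_cycle_partner_edge(2)[OF assms(1)] by blast
    show "successively (\<lambda>u v. {u, v} \<in> E) ?zs" using cl unfolding closed_walk_def by blast
    show "?zs = [] \<or> hd ?zs \<in> X" using x(2) by simp
    fix v assume "v \<in> set ?zs"
    then have v: "v \<in> set vs" unfolding zs(2) .
    then have "cyc_gap ?zs v (partner v) \<or> cyc_gap ?zs (partner v) v"
      using adj_ws[of v] cyc_gap_rotate[of A B] unfolding us[symmetric] AB(1) by simp
    moreover have "partner (partner v) = v"
      using partner_partner[OF M_cycle_partner_edge(2)[OF assms(1) v]] .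
    \<comment> \<open>The closing pair is therefore not a matching edge, so each matching edge of
      the cycle joins consecutive entries of the list and \<open>unweave\<close> applies.\<close>
    moreover have "last ?zs \<noteq> partner x" using zs(1,3) assms(2) by (cases us rule: rev_cases) auto
    ultimately show "gap ?zs v (partner v) \<or> gap ?zs (partner v) v"
      by (auto simp: cyc_gap_def)
  qed
  then obtain xs where xs: "set xs \<subseteq> X" "?zs = weave xs" by blast
  have len: "3 \<le> length xs" using zs(3) assms(2) length_weave[of xs] unfolding xs(2) by linarith
  have dist: "distinct xs" using distinct_of_weave[of xs] zs(1) unfolding xs(2) by blast
  have "closed_walk arc (rev xs)"
    using cl closed_walk_arc[OF xs(1) dist] len closed_walk_weave[OF xs(1)] unfolding xs(2) by simp
  moreover have "set xs \<subseteq> set vs" using zs(2) unfolding xs(2) by auto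
  ultimately have "closed_walk arc (rev xs) \<and> 3 \<le> length (rev xs) \<and> distinct (rev xs) \<and> set (rev xs) \<subseteq> set vs \<inter> X"
    using len dist xs(1) by simp
  then show ?thesis by blast
qed

lemma gap_weave: "x \<in> set xs \<Longrightarrow> gap (weave xs) x (partner x)"
proof (induction xs)
  case (Cons a xs)
  then show ?case by (auto simp: gap_Cons_iff)
qed simp

lemma weave_M_cycle:
  assumes "closed_walk arc xs" "3 \<le> length xs" "distinct xs" "set xs \<subseteq> X"
  shows "M_cycle E M (weave (rev xs))" "6 \<le> length (weave (rev xs))"
proof -
  let ?vs = "weave (rev xs)"
  show len: "6 \<le> length ?vs" unfolding length_weave using assms(2) by simp
  have "closed_walk (\<lambda>x x'. {x', partner x} \<in> E) (rev xs)"
    using closed_walk_arc[of "rev xs"] assms by simp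
  then have "closed_walk (\<lambda>u v. {u, v} \<in> E) ?vs" using closed_walk_weave[of "rev xs"] assms(4) by simp
  moreover have "distinct ?vs" using assms(3,4) by (intro distinct_weave) auto
  ultimately have cyc: "is_cycle E ?vs" using len unfolding is_cycle_iff by linarith
  \<comment> \<open>Weaving puts one matching edge at each \<open>x\<close>; there are no others,
    because the matching edge at a vertex is unique.\<close>
  have eq: "cycle_edges ?vs \<inter> M = (\<lambda>x. {x, partner x}) ` set xs"
  proof (intro equalityI subsetI)
    fix e assume e: "e \<in> cycle_edges ?vs \<inter> M"
    then have "e \<subseteq> set ?vs" "e \<noteq> {}" using cycle_edge_subset[of e ?vs] by auto
    then obtain v where v: "v \<in> e" "v \<in> set ?vs" by blast
    then obtain x where x: "x \<in> set xs" "v = x \<or> v = partner x" unfolding set_weave set_rev by blast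
    have xX: "x \<in> X" using x(1) assms(4) by auto
    have "v \<in> X \<union> Y" "v \<in> {x, partner x}" using x(2) xX partner_X[of x] by auto
    then have "e = {x, partner x}" using M_unique[of v e "{x, partner x}"] partner[of x] e v xX by blast
    then show "e \<in> (\<lambda>x. {x, partner x}) ` set xs" using x(1) by blast
  next
    fix e assume "e \<in> (\<lambda>x. {x, partner x}) ` set xs"
    then obtain x where "x \<in> set xs" "e = {x, partner x}" by blast
    then show "e \<in> cycle_edges ?vs \<inter> M"
      using gap_cycle_edge[OF gap_weave[of x "rev xs"]] partner[of x] assms(4) by auto
  qed
  have "inj_on (\<lambda>x. {x, partner x}) (set xs)"
  proof (rule inj_onI)
    fix x x' assume *: "x \<in> set xs" "x' \<in> set xs" "{x, partner x} = {x', partner x'}"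
    then have "x \<in> X" "x' \<in> X" using assms(4) by auto
    then have "x \<noteq> partner x'" using partner_X[of x'] not_in_Y by auto
    then show "x = x'" using *(3) by (auto simp: doubleton_eq_iff)
  qed
  then have "card (cycle_edges ?vs \<inter> M) = length (rev xs)"
    unfolding eq using assms(3) by (simp only: card_image distinct_card length_rev)
  then show "M_cycle E M ?vs" unfolding M_cycle_def length_weave using cyc by (simp only: simp_thms)
qed

lemma packing_of_M_cycles:
  assumes "vertex_disjoint cs" "\<forall>c\<in>set cs. M_cycle E M c \<and> 6 \<le> length c"
  shows "\<exists>Cs. length Cs = length cs \<and> packing arc 3 X Cs \<and> set (concat Cs) \<subseteq> set (concat cs)"
  using assms
proof (induction cs)
  case Nil
  then show ?case by (intro exI[of _ "[]"]) (simp add: packing_def)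
next
  case (Cons c cs)
  then obtain Cs where Cs: "length Cs = length cs" "packing arc 3 X Cs" "set (concat Cs) \<subseteq> set (concat cs)"
    by (auto simp: vertex_disjoint_Cons)
  obtain xs where xs: "closed_walk arc xs" "3 \<le> length xs" "distinct xs" "set xs \<subseteq> set c \<inter> X"
    using M_cycle_imp_closed_walk[of c] Cons.prems(2) by auto
  have "set c \<inter> set (concat cs) = {}" using Cons.prems(1) by (auto simp: vertex_disjoint_Cons)
  then have "set xs \<inter> set (concat Cs) = {}" using xs(4) Cs(3) by blast
  then have "distinct (concat (xs # Cs))" using Cs(2) xs(3) unfolding packing_def by simp
  moreover have "set (concat (xs # Cs)) \<subseteq> X" using Cs(2) xs(4) unfolding packing_def by simp
  moreover have "\<forall>C\<in>set (xs # Cs). closed_walk arc C \<and> 3 \<le> length C" using Cs(2) xs(1,2) unfolding packing_def by simp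
  ultimately have "packing arc 3 X (xs # Cs)" unfolding packing_def by blast
  moreover have "set (concat (xs # Cs)) \<subseteq> set (concat (c # cs))" using xs(4) Cs(3) by auto
  moreover have "length (xs # Cs) = length (c # cs)" using Cs(1) by simp
  ultimately show ?case by blast
qed

lemma M_two_factor_of_partition:
  assumes "cycle_partition arc 3 k X"
  shows "\<exists>cs. length cs = k \<and> M_two_factor (X \<union> Y) E M cs \<and> (\<forall>c\<in>set cs. 6 \<le> length c)"
proof -
  obtain Cs where Cs: "length Cs = k" "\<forall>C\<in>set Cs. closed_walk arc C \<and> 3 \<le> length C"
    "distinct (concat Cs)" "set (concat Cs) = X"
    using assms by (auto simp: cycle_partition_def)
  let ?cs = "map (\<lambda>C. weave (rev C)) Cs"
  have sub: "set C \<subseteq> X" "distinct C" if "C \<in> set Cs" for C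
    using that Cs(3,4) by (auto simp: distinct_concat_iff)
  have cyc: "M_cycle E M c \<and> 6 \<le> length c" if c: "c \<in> set ?cs" for c
  proof -
    obtain C where C: "C \<in> set Cs" "c = weave (rev C)" using c unfolding set_map by blast
    show ?thesis unfolding C(2) using weave_M_cycle[of C] Cs(2) sub C(1) by blast
  qed
  have eq: "mset (concat ?cs) = mset (weave (concat Cs))"
  proof (induction Cs)
    case (Cons C Cs)
    have "mset (weave (rev C)) = mset (weave C)" by (induction C) simp_all
    then show ?case using Cons by simp
  qed simp
  have "distinct (concat ?cs)"
    using mset_eq_imp_distinct_iff[OF eq] distinct_weave[OF _ Cs(3)] Cs(4) by simp
  then have "vertex_disjoint ?cs" by (simp add: distinct_concat_iff_vertex_disjoint)
  moreover have "(\<Union>c\<in>set ?cs. set c) = X \<union> Y"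
  proof -
    have "Y \<subseteq> partner ` X" using partner_partner partner_Y by (metis UnCI image_iff subsetI)
    then have "X \<union> partner ` X = X \<union> Y" using partner_X by blast
    moreover have "(\<Union>c\<in>set ?cs. set c) = set (weave (concat Cs))"
      using mset_eq_setD[OF eq] by simp
    ultimately show ?thesis unfolding set_weave Cs(4) by simp
  qed
  ultimately have "M_two_factor (X \<union> Y) E M ?cs" unfolding M_two_factor_def using cyc by blast
  moreover have "\<forall>c\<in>set ?cs. 6 \<le> length c" using cyc by blast
  moreover have "length ?cs = k" using Cs(1) by (simp only: length_map)
  ultimately show ?thesis by blast
qed

end

theorem theorem4:
  fixes X Y :: "'a set" and E M :: "'a set set" and k n :: nat
  assumes "k \<ge> 1"
    and "bipartite_graph X Y E"
    and "card X = n" and "card Y = n"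
    and "2 * n > 6 * (k + 1)"
    and "perfect_matching (X \<union> Y) E M"
    and "\<exists>cs. length cs = k + 1 \<and> vertex_disjoint cs \<and>
           (\<forall>c \<in> set cs. M_cycle E M c \<and> length c \<ge> 6)"
    and "sigma11 X Y E \<ge> enat (n + 2)"
  shows "\<exists>cs. length cs = k \<and> M_two_factor (X \<union> Y) E M cs \<and> (\<forall>c \<in> set cs. length c \<ge> 6)"
proof -
  interpret matched_bipartite X Y E M using assms(2,6) by unfold_locales
  obtain Cs where Cs: "length Cs = Suc k" "packing arc 3 X Cs"
    using assms(7) packing_of_M_cycles by (metis Suc_eq_plus1)
  have "cycle_partition arc 3 k X"
  proof (rule packing_cycle_partition_pred[OF _ _ _ Cs(2,1)])
    show "woodall arc X" using woodall_arc assms(3,8) by simp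
    show "\<not> arc x x" for x by (simp add: arc_def)
  qed (use finite_parts assms(1,3,5) in auto)
  then show ?thesis by (rule M_two_factor_of_partition)
qed

end
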